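(* Let $k$ be a field of characteristic zero, let $S=k[x_1,\ldots,x_n]$ be a polynomial ring graded by $\deg(x_i)=d_i>0$, and let $I\subseteq S$ be a proper monomial ideal that is $\operatorname{lcm}$-strongly Golod. Then $S/I$ is weakly Golod.
   Context: For a monomial $m\in S$ and a monomial ideal $L\subseteq S$, $L_m\subseteq L$ denotes the ideal of $S$ generated by the monomials of $L$ which divide $m$. For an ideal $I\subseteq S$, $\partial(I)$ denotes the ideal of $S$ generated by all partial derivatives $\partial f/\partial x_i$ of elements $f\in I$; if $I$ is monomial then so is $\partial(I)$. For a monomial ideal $I$, $\operatorname{lcm}(I)$ denotes the least common multiple of the minimal monomial generators of $I$, and, with $m=\operatorname{lcm}(I)$, set $\partial(I)^{[2]}:=(\partial(I)^2)_m$. A monomial ideal $I$ is called $\operatorname{lcm}$-strongly Golod if $\partial(I)^{[2]}\subseteq I$. For a proper homogeneous ideal $I\subseteq S$, the ring $R=S/I$ is called weakly Golod if the multiplication on Koszul homology in positive degrees is identically zero, i.e. $\alpha\beta=0$ for all $\alpha\in H_i(R)$, $\beta\in H_j(R)$ with $i,j\geq 1$, where $H_\bullet(R)$ is the homology of the Koszul complex on $x_1,\ldots,x_n$ over $R$ with its induced algebra structure. *)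

theory Defs
  imports "HOL-Algebra.Algebra" "HOL-Algebra.Algebraic_Closure_Type" "HOL-Library.Poly_Mapping"
begin

section \<open>The polynomial ring and its monomials\<close>

text \<open>
  The polynomial ring in the (nonempty, finite) set of variables \<open>'n\<close> is the monoid algebra over
  the exponent vectors \<open>'n \<Rightarrow>\<^sub>0 nat\<close>; the number \<open>n\<close> of variables is \<open>CARD('n)\<close>. The linear order
  on \<open>'n\<close> only matters for the signs in the exterior algebra below.
\<close>

type_synonym ('n, 'k) mpoly = "('n \<Rightarrow>\<^sub>0 nat) \<Rightarrow>\<^sub>0 'k"

definition mpoly_ring :: "('n::finite, 'k::field) mpoly ring" where
  "mpoly_ring = ring_of_type_algebra"

definition monomial :: "('n \<Rightarrow>\<^sub>0 nat) \<Rightarrow> ('n::finite, 'k::field) mpoly" where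
  "monomial a = Poly_Mapping.single a 1"

definition monomials :: "('n::finite, 'k::field) mpoly set" where
  "monomials = range monomial"

definition mpoly_var :: "'n \<Rightarrow> ('n::finite, 'k::field) mpoly" where
  "mpoly_var i = monomial (Poly_Mapping.single i 1)"

definition partial_deriv ::
    "'n \<Rightarrow> ('n::finite, 'k::field) mpoly \<Rightarrow> ('n, 'k) mpoly" where
  "partial_deriv i f =
     (\<Sum>a\<in>Poly_Mapping.keys f.
        Poly_Mapping.single (a - Poly_Mapping.single i 1)
          (of_nat (Poly_Mapping.lookup a i) * Poly_Mapping.lookup f a))"


section \<open>Monomial ideals\<close>

definition monomial_ideal :: "('n::finite, 'k::field) mpoly set \<Rightarrow> bool" where
  "monomial_ideal I \<longleftrightarrow> (\<exists>M \<subseteq> monomials. I = Idl\<^bsub>mpoly_ring\<^esub> M)"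

definition trunc_ideal ::
    "('n::finite, 'k::field) mpoly set \<Rightarrow> ('n, 'k) mpoly \<Rightarrow> ('n, 'k) mpoly set" where
  "trunc_ideal L m = Idl\<^bsub>mpoly_ring\<^esub> {u \<in> monomials \<inter> L. u dvd m}"

definition deriv_ideal ::
    "('n::finite, 'k::field) mpoly set \<Rightarrow> ('n, 'k) mpoly set" where
  "deriv_ideal I = Idl\<^bsub>mpoly_ring\<^esub> {partial_deriv i f | i f. f \<in> I}"

definition min_gens ::
    "('n::finite, 'k::field) mpoly set \<Rightarrow> ('n, 'k) mpoly set" where
  "min_gens I = {u \<in> monomials \<inter> I. \<forall>v \<in> monomials \<inter> I. v dvd u \<longrightarrow> v = u}"

text \<open>The least common multiple is normalised to be a monomial; it is \<open>1\<close> for the zero ideal.\<close>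

definition lcm_ideal :: "('n::finite, 'k::field) mpoly set \<Rightarrow> ('n, 'k) mpoly" where
  "lcm_ideal I = (THE m. m \<in> monomials \<and> (\<forall>u \<in> min_gens I. u dvd m) \<and>
                    (\<forall>m' \<in> monomials. (\<forall>u \<in> min_gens I. u dvd m') \<longrightarrow> m dvd m'))"

definition deriv_ideal_sq ::
    "('n::finite, 'k::field) mpoly set \<Rightarrow> ('n, 'k) mpoly set" where
  "deriv_ideal_sq I =
     trunc_ideal (deriv_ideal I \<cdot>\<^bsub>mpoly_ring\<^esub> deriv_ideal I) (lcm_ideal I)"

definition lcm_strongly_Golod :: "('n::finite, 'k::field) mpoly set \<Rightarrow> bool" where
  "lcm_strongly_Golod I \<longleftrightarrow> monomial_ideal I \<and> deriv_ideal_sq I \<subseteq> I"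


section \<open>Homogeneous ideals for the grading with \<open>deg x\<^sub>i = d i\<close>\<close>

definition weighted_degree :: "('n::finite \<Rightarrow> nat) \<Rightarrow> ('n \<Rightarrow>\<^sub>0 nat) \<Rightarrow> nat" where
  "weighted_degree d a = (\<Sum>i\<in>UNIV. Poly_Mapping.lookup a i * d i)"

definition homogeneous_poly ::
    "('n::finite \<Rightarrow> nat) \<Rightarrow> ('n, 'k::field) mpoly \<Rightarrow> bool" where
  "homogeneous_poly d f \<longleftrightarrow> (\<exists>e. \<forall>a \<in> Poly_Mapping.keys f. weighted_degree d a = e)"

definition homogeneous_ideal ::
    "('n::finite \<Rightarrow> nat) \<Rightarrow> ('n, 'k::field) mpoly set \<Rightarrow> bool" where
  "homogeneous_ideal d I \<longleftrightarrow> (\<exists>F. (\<forall>f \<in> F. homogeneous_poly d f) \<and> I = Idl\<^bsub>mpoly_ring\<^esub> F)"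


section \<open>The Koszul algebra of a family of ring elements and its homology\<close>

text \<open>
  The Koszul complex over a commutative ring \<open>R\<close> is the exterior algebra on a free module with
  basis \<open>(e\<^sub>i)\<close> indexed by \<open>'n\<close>. A chain is represented by its coefficient function: \<open>z A\<close> is the
  coefficient of \<open>e\<^sub>A = e\<^sub>a \<and> e\<^sub>b \<and> \<dots>\<close>, where \<open>A = {a < b < \<dots>}\<close>.
\<close>

definition signed :: "('a, 'm) ring_scheme \<Rightarrow> nat \<Rightarrow> 'a \<Rightarrow> 'a" where
  "signed R k r = (if even k then r else \<ominus>\<^bsub>R\<^esub> r)"

text \<open>For disjoint \<open>A\<close> and \<open>B\<close>, \<open>e\<^sub>A \<and> e\<^sub>B = (-1)^(inversions A B) e\<^sub>A\<^sub>\<union>\<^sub>B\<close>.\<close>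

definition inversions :: "'n::linorder set \<Rightarrow> 'n set \<Rightarrow> nat" where
  "inversions A B = card {(a, b). a \<in> A \<and> b \<in> B \<and> b < a}"

definition koszul_algebra ::
    "('a, 'm) ring_scheme \<Rightarrow> ('n::{finite,linorder} set \<Rightarrow> 'a) ring" where
  "koszul_algebra R =
     \<lparr>carrier = {z. \<forall>A. z A \<in> carrier R},
      monoid.mult = (\<lambda>z w C. \<Oplus>\<^bsub>R\<^esub>A\<in>Pow C. signed R (inversions A (C - A)) (z A \<otimes>\<^bsub>R\<^esub> w (C - A))),
      one = (\<lambda>A. if A = {} then \<one>\<^bsub>R\<^esub> else \<zero>\<^bsub>R\<^esub>),
      ring.zero = (\<lambda>A. \<zero>\<^bsub>R\<^esub>),
      add = (\<lambda>z w A. z A \<oplus>\<^bsub>R\<^esub> w A)\<rparr>"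

definition koszul_chains ::
    "('a, 'm) ring_scheme \<Rightarrow> nat \<Rightarrow> ('n::{finite,linorder} set \<Rightarrow> 'a) set" where
  "koszul_chains R i =
     {z \<in> carrier (koszul_algebra R). \<forall>A. card A \<noteq> i \<longrightarrow> z A = \<zero>\<^bsub>R\<^esub>}"

text \<open>
  The differential is the \<open>R\<close>-linear map with
  \<open>e\<^sub>A \<mapsto> \<Sum>a\<in>A. (-1)^(inversions {a} (A - {a})) x\<^sub>a e\<^bsub>A - {a}\<^esub>\<close>, that is, the antiderivation with
  \<open>e\<^sub>a \<mapsto> x\<^sub>a\<close>. Below, \<open>A = insert a B\<close>.
\<close>

definition koszul_diff ::
    "('a, 'm) ring_scheme \<Rightarrow> ('n::{finite,linorder} \<Rightarrow> 'a) \<Rightarrow> ('n set \<Rightarrow> 'a) \<Rightarrow> ('n set \<Rightarrow> 'a)" where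
  "koszul_diff R x z =
     (\<lambda>B. \<Oplus>\<^bsub>R\<^esub>a\<in>-B. signed R (inversions {a} B) (x a \<otimes>\<^bsub>R\<^esub> z (insert a B)))"

definition koszul_cycles ::
    "('a, 'm) ring_scheme \<Rightarrow> ('n::{finite,linorder} \<Rightarrow> 'a) \<Rightarrow> ('n set \<Rightarrow> 'a) set" where
  "koszul_cycles R x =
     {z \<in> carrier (koszul_algebra R). koszul_diff R x z = \<zero>\<^bsub>koszul_algebra R\<^esub>}"

definition koszul_boundaries ::
    "('a, 'm) ring_scheme \<Rightarrow> ('n::{finite,linorder} \<Rightarrow> 'a) \<Rightarrow> ('n set \<Rightarrow> 'a) set" where
  "koszul_boundaries R x = koszul_diff R x ` carrier (koszul_algebra R)"

text \<open>
  The cycles form a subring of the Koszul algebra, with the boundaries as a two-sided ideal. The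
  homology algebra is the quotient, and its component of degree \<open>i\<close> consists of the classes of
  the cycles of degree \<open>i\<close>.
\<close>

definition koszul_homology ::
    "('a, 'm) ring_scheme \<Rightarrow> ('n::{finite,linorder} \<Rightarrow> 'a) \<Rightarrow> ('n set \<Rightarrow> 'a) set ring" where
  "koszul_homology R x =
     (koszul_algebra R)\<lparr>carrier := koszul_cycles R x\<rparr> Quot koszul_boundaries R x"

definition koszul_homology_deg ::
    "('a, 'm) ring_scheme \<Rightarrow> ('n::{finite,linorder} \<Rightarrow> 'a) \<Rightarrow> nat \<Rightarrow> ('n set \<Rightarrow> 'a) set set" where
  "koszul_homology_deg R x i =
     {koszul_boundaries R x +>\<^bsub>koszul_algebra R\<^esub> z | z. z \<in> koszul_cycles R x \<inter> koszul_chains R i}"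


section \<open>Weakly Golod quotients\<close>

definition quotient_var ::
    "('n::finite, 'k::field) mpoly set \<Rightarrow> 'n \<Rightarrow> ('n, 'k) mpoly set" where
  "quotient_var I i = I +>\<^bsub>mpoly_ring\<^esub> mpoly_var i"

text \<open>
  \<open>weakly_Golod d I\<close> says that \<open>S/I\<close> is weakly Golod. The notion is only defined for proper ideals
  that are homogeneous for the grading given by \<open>d\<close>, hence the first two conjuncts.
\<close>

definition weakly_Golod ::
    "('n::{finite,linorder} \<Rightarrow> nat) \<Rightarrow> ('n, 'k::field) mpoly set \<Rightarrow> bool" where
  "weakly_Golod d I \<longleftrightarrow>
     homogeneous_ideal d I \<and> I \<noteq> carrier mpoly_ring \<and>
     (let R = mpoly_ring Quot I; x = quotient_var I; H = koszul_homology R x in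
        \<forall>i j. i \<ge> 1 \<longrightarrow> j \<ge> 1 \<longrightarrow>
          (\<forall>\<alpha> \<in> koszul_homology_deg R x i. \<forall>\<beta> \<in> koszul_homology_deg R x j.
             \<alpha> \<otimes>\<^bsub>H\<^esub> \<beta> = \<zero>\<^bsub>H\<^esub>))"

end

theory Submission
  imports Defs
begin

text \<open>
  Let \<open>K\<close> be the Koszul complex of \<open>x\<^sub>1, \<dots>, x\<^sub>n\<close> over \<open>S\<close>, with its grading by exponent vectors. In
  every nonzero multidegree \<open>K\<close> is contractible, and in many ways: for each variable \<open>x\<^sub>i\<close> of positive
  degree there is a contraction \<open>h\<^sub>i\<close> with \<open>\<partial> h\<^sub>i + h\<^sub>i \<partial> = 1\<close>, which divides coefficients by
  \<open>x\<^sub>i\<close> and multiplies by \<open>e\<^sub>i\<close> (\<open>lookup_homotopy_identity\<close>). The proof uses two choices of the variable.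

  First, let \<open>z\<close> be a cycle of positive degree over \<open>S/I\<close>, lifted to \<open>K\<close>, so that \<open>\<partial>z\<close> has
  coefficients in \<open>I\<close>. For any choice of variables, \<open>z = \<partial>(h z) + h(\<partial>z)\<close>; hence the class of \<open>z\<close> is
  represented by \<open>h(\<partial>z)\<close>, whose coefficients are combinations of monomials of \<open>I\<close> divided by a
  variable. In characteristic zero these lie in \<open>\<partial>(I)\<close>. So a product of two homology classes of
  positive degree is represented by a chain \<open>p\<close> with coefficients in \<open>\<partial>(I)\<^sup>2\<close>.

  Secondly, let \<open>m\<close> be the exponent of \<open>lcm(I)\<close> and consider the component of \<open>p\<close> in multidegree \<open>c\<close>.
  If \<open>c \<le> m\<close>, the monomials in its coefficients divide \<open>lcm(I)\<close>, so they lie in \<open>\<partial>(I)\<^sup>[\<^sup>2\<^sup>]\<close> and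
  hence in \<open>I\<close>, and the component vanishes over \<open>S/I\<close>. Otherwise \<open>c\<^sub>i > m\<^sub>i\<close> for some \<open>i\<close>. No minimal
  generator of \<open>I\<close> has \<open>x\<^sub>i\<close>-exponent larger than \<open>m\<^sub>i\<close>, so \<open>h\<^sub>i\<close> maps chains over \<open>I\<close> of multidegree
  \<open>c\<close> to chains over \<open>I\<close>. It therefore contracts the Koszul complex of \<open>S/I\<close> in this multidegree, and
  the component is a boundary. Both steps are carried out in \<open>kprod_boundary_modulo\<close>, using the
  Leibniz rule \<open>kdiff_kprod\<close>; \<open>exponent_reduce_above_lcm\<close> and \<open>lcm_strongly_Golod_exponents\<close> verify its
  hypotheses.
\<close>

section \<open>Signs and the Leibniz rule in the Koszul algebra over a commutative ring\<close>

lemma inversions_Un_left: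
  fixes A A' B :: "'n::{finite,linorder} set"
  assumes "A \<inter> A' = {}"
  shows "inversions (A \<union> A') B = inversions A B + inversions A' B"
proof -
  have "{(a, b). a \<in> A \<union> A' \<and> b \<in> B \<and> b < a} =
        {(a, b). a \<in> A \<and> b \<in> B \<and> b < a} \<union> {(a, b). a \<in> A' \<and> b \<in> B \<and> b < a}"
    by auto
  then show ?thesis
    unfolding inversions_def using assms by (simp add: card_Un_disjoint disjoint_iff)
qed

lemma inversions_Un_right:
  fixes A B B' :: "'n::{finite,linorder} set"
  assumes "B \<inter> B' = {}"
  shows "inversions A (B \<union> B') = inversions A B + inversions A B'"
proof -
  have "{(a, b). a \<in> A \<and> b \<in> B \<union> B' \<and> b < a} =
        {(a, b). a \<in> A \<and> b \<in> B \<and> b < a} \<union> {(a, b). a \<in> A \<and> b \<in> B' \<and> b < a}"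
    by auto
  then show ?thesis
    unfolding inversions_def using assms by (simp add: card_Un_disjoint disjoint_iff)
qed

lemma inversions_swap:
  fixes a :: "'n::{finite,linorder}"
  assumes "a \<notin> B"
  shows "inversions {a} B + inversions B {a} = card B"
proof -
  have "{(x, b). x \<in> {a} \<and> b \<in> B \<and> b < x} = Pair a ` {b \<in> B. b < a}"
    and "{(b, x). b \<in> B \<and> x \<in> {a} \<and> x < b} = (\<lambda>b. (b, a)) ` {b \<in> B. a < b}"
    by auto
  then have "inversions {a} B + inversions B {a} = card {b \<in> B. b < a} + card {b \<in> B. a < b}"
    unfolding inversions_def by (simp add: card_image inj_on_def)
  also have "\<dots> = card ({b \<in> B. b < a} \<union> {b \<in> B. a < b})"
    by (subst card_Un_disjoint) auto
  also have "{b \<in> B. b < a} \<union> {b \<in> B. a < b} = B"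
    using assms by (auto simp: not_less order.order_iff_strict)
  finally show ?thesis .
qed

definition esign :: "'n::{finite,linorder} set \<Rightarrow> 'n set \<Rightarrow> 'a::comm_ring_1" where
  "esign A B = (-1) ^ inversions A B"

lemma esign_square [simp]: "esign A B * esign A B = 1"
  by (simp add: esign_def flip: power_mult_distrib)

lemma esign_square_left [simp]: "esign A B * (esign A B * y) = y"
  by (simp flip: mult.assoc)

lemma esign_mult_eq_0_iff [simp]: "esign A B * y = 0 \<longleftrightarrow> y = 0"
  by (metis esign_square_left mult_zero_right)

lemma esign_insert_left: "a \<notin> A \<Longrightarrow> esign (insert a A) B = esign {a} B * esign A B"
  using inversions_Un_left[of "{a}" A B] by (simp add: esign_def power_add)

lemma esign_insert_right: "b \<notin> B \<Longrightarrow> esign A (insert b B) = esign A {b} * esign A B"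
  using inversions_Un_right[of "{b}" B A] by (simp add: esign_def power_add)

lemma esign_Un_right: "B \<inter> B' = {} \<Longrightarrow> esign A (B \<union> B') = esign A B * esign A B'"
  using inversions_Un_right[of B B' A] by (simp add: esign_def power_add)

lemma esign_swap: "a \<notin> B \<Longrightarrow> esign {a} B * esign B {a} = (-1) ^ card B"
  by (simp add: esign_def inversions_swap flip: power_add)

lemma esign_anticommute: "a \<noteq> b \<Longrightarrow> esign {b} {a} = - esign {a} {b}"
proof -
  assume "a \<noteq> b"
  then have "esign {a} {b} * esign {b} {a} = (- 1 :: 'b)"
    using esign_swap[of a "{b}"] by simp
  then have "esign {a} {b} * (esign {a} {b} * esign {b} {a}) = - (esign {a} {b} :: 'b)"
    by simp
  then show ?thesis
    by (simp only: esign_square_left)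
qed

text \<open>
The product and the differential of the Koszul algebra over a ring that is a whole type, so that the
calculations below can use type-class sums and signs.
\<close>

definition kprod :: "('n::{finite,linorder} set \<Rightarrow> 'a::comm_ring_1) \<Rightarrow> ('n set \<Rightarrow> 'a) \<Rightarrow> 'n set \<Rightarrow> 'a" where
  "kprod u v C = (\<Sum>A\<in>Pow C. esign A (C - A) * (u A * v (C - A)))"

definition kdiff :: "('n::{finite,linorder} \<Rightarrow> 'a::comm_ring_1) \<Rightarrow> ('n set \<Rightarrow> 'a) \<Rightarrow> 'n set \<Rightarrow> 'a" where
  "kdiff x z B = (\<Sum>a\<in>-B. esign {a} B * (x a * z (insert a B)))"

text \<open>
The grading automorphism of the exterior algebra, which provides the sign in the Leibniz rule.
\<close>

definition grade_sign :: "('n::finite set \<Rightarrow> 'a::comm_ring_1) \<Rightarrow> 'n set \<Rightarrow> 'a" where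
  "grade_sign u A = (-1) ^ card A * u A"

lemma kdiff_add: "kdiff x (\<lambda>A. u A + v A) B = kdiff x u B + kdiff x v B"
  by (simp add: kdiff_def distrib_left sum.distrib)

lemma kprod_add_left: "kprod (\<lambda>A. u A + u' A) v C = kprod u v C + kprod u' v C"
  by (simp add: kprod_def distrib_left distrib_right sum.distrib)

lemma kprod_add_right: "kprod u (\<lambda>A. v A + v' A) C = kprod u v C + kprod u v' C"
  by (simp add: kprod_def distrib_left distrib_right sum.distrib)

lemma grade_sign_grade_sign [simp]: "grade_sign (grade_sign u) = u"
  by (rule ext) (simp add: grade_sign_def flip: mult.assoc power_mult_distrib)

lemma kdiff_grade_sign: "kdiff x (grade_sign u) = (\<lambda>B. - grade_sign (kdiff x u) B)"
proof
  fix B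
  have "esign {a} B * (x a * grade_sign u (insert a B)) =
        - ((-1) ^ card B * (esign {a} B * (x a * u (insert a B))))" if "a \<in> -B" for a
    using that by (simp add: grade_sign_def ac_simps)
  then have "kdiff x (grade_sign u) B =
      (\<Sum>a\<in>-B. - ((-1) ^ card B * (esign {a} B * (x a * u (insert a B)))))"
    unfolding kdiff_def by (intro sum.cong) auto
  then show "kdiff x (grade_sign u) B = - grade_sign (kdiff x u) B"
    unfolding kdiff_def grade_sign_def sum_distrib_left sum_negf .
qed

text \<open>
Pairing \<open>(a, b)\<close> with \<open>(b, a)\<close> for \<open>a < b\<close>, rather than comparing the sum with its negative, keeps
this valid in characteristic two.
\<close>

lemma sum_pairs_antisym_zero:
  fixes f :: "'n::{finite,linorder} \<Rightarrow> 'n \<Rightarrow> 'a::comm_ring_1"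
  assumes "\<And>a b. a \<in> T \<Longrightarrow> b \<in> T \<Longrightarrow> a \<noteq> b \<Longrightarrow> f b a = - f a b"
  shows "(\<Sum>a\<in>T. \<Sum>b\<in>T - {a}. f a b) = 0"
proof -
  have split: "(\<Sum>b\<in>T - {a}. f a b) = (\<Sum>b | b \<in> T \<and> a < b. f a b) + (\<Sum>b | b \<in> T \<and> b < a. f a b)"
    for a
  proof -
    have "T - {a} = {b. b \<in> T \<and> a < b} \<union> {b. b \<in> T \<and> b < a}" by auto
    moreover have "{b. b \<in> T \<and> a < b} \<inter> {b. b \<in> T \<and> b < a} = {}" by auto
    ultimately show ?thesis by (simp add: sum.union_disjoint)
  qed
  have "(\<Sum>a\<in>T. \<Sum>b | b \<in> T \<and> b < a. f a b) = (\<Sum>b\<in>T. \<Sum>a | a \<in> T \<and> b < a. f a b)"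
    by (rule sum.swap_restrict) simp_all
  also have "\<dots> = (\<Sum>b\<in>T. \<Sum>a | a \<in> T \<and> b < a. - f b a)"
    using assms by (intro sum.cong) auto
  finally show ?thesis
    by (simp add: split sum.distrib sum_negf)
qed

lemma kdiff_kdiff: "kdiff x (kdiff x z) = (\<lambda>B. 0)"
proof
  fix B :: "'a set"
  define f where "f a b = esign {a} B * (x a * (esign {b} (insert a B) * (x b * z (insert b (insert a B)))))"
    for a b
  have "kdiff x (kdiff x z) B = (\<Sum>a\<in>-B. \<Sum>b\<in>-B - {a}. f a b)"
    unfolding kdiff_def f_def sum_distrib_left by (intro sum.cong) auto
  also have "\<dots> = 0"
  proof (rule sum_pairs_antisym_zero)
    fix a b assume "a \<in> -B" "b \<in> -B" "a \<noteq> b"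
    then show "f b a = - f a b"
      by (simp add: f_def esign_insert_right[of a B] esign_insert_right[of b B]
          esign_anticommute[of a b] insert_commute[of a b] ac_simps)
  qed
  finally show "kdiff x (kdiff x z) B = 0" .
qed

text \<open>
The Leibniz rule. Expanding the left-hand side, the added index \<open>a\<close> lies outside \<open>C\<close> and belongs
either to the left factor (the terms \<open>T1\<close>) or to the right factor (the terms \<open>T2\<close>). The right-hand
side contains these terms and, besides, those with \<open>a\<close> inside \<open>C\<close>, where \<open>a\<close> occurs in both
factors; they cancel in pairs, by moving \<open>a\<close> from \<open>C - A\<close> to \<open>A\<close>.
\<close>

lemma kdiff_kprod:
  fixes u v :: "'n::{finite,linorder} set \<Rightarrow> 'a::comm_ring_1"
  shows "kdiff x (kprod u v) C = kprod (kdiff x u) v C + kprod (grade_sign u) (kdiff x v) C"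
proof -
  define T1 where "T1 a A = esign {a} A * esign A (C - A) * (x a * u (insert a A) * v (C - A))" for a A
  define T2 where "T2 a A = (-1) ^ card A * esign A (C - A) * esign {a} (C - A) * (x a * u A * v (insert a (C - A)))" for a A
  have lhs: "esign {a} C * (x a * kprod u v (insert a C)) = (\<Sum>A\<in>Pow C. T1 a A + T2 a A)"
    if a: "a \<in> -C" for a
  proof -
    let ?g = "\<lambda>A. esign A (insert a C - A) * (u A * v (insert a C - A))"
    have inj: "inj_on (insert a) (Pow C)"
      using a by (auto simp: inj_on_def)
    have "kprod u v (insert a C) = (\<Sum>A\<in>Pow C. ?g A) + (\<Sum>A\<in>insert a ` Pow C. ?g A)"
      unfolding kprod_def Pow_insert using a by (intro sum.union_disjoint) auto
    also have "(\<Sum>A\<in>insert a ` Pow C. ?g A) = (\<Sum>A\<in>Pow C. ?g (insert a A))"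
      by (simp add: sum.reindex inj)
    finally have eq: "kprod u v (insert a C) = (\<Sum>A\<in>Pow C. ?g (insert a A) + ?g A)"
      by (simp add: sum.distrib add.commute)
    show ?thesis
      unfolding eq sum_distrib_left
    proof (intro sum.cong refl)
      fix A assume "A \<in> Pow C"
      then have A: "A \<subseteq> C" "a \<notin> A" "a \<notin> C - A" and C: "C = A \<union> (C - A)" "A \<inter> (C - A) = {}"
        using a by auto
      have 1: "insert a C - insert a A = C - A" and 2: "insert a C - A = insert a (C - A)"
        using a A by auto
      have s: "esign {a} C = esign {a} A * (esign {a} (C - A) :: 'a)"
        using esign_Un_right[OF C(2), of "{a}"] C(1) by simp
      have sw: "esign A {a} = esign {a} A * ((-1) ^ card A :: 'a)"
        using esign_swap[OF A(2)] esign_square_left[of "{a}" A "esign A {a}"] by metis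
      have "esign {a} C * (x a * ?g (insert a A)) = T1 a A"
        unfolding 1 T1_def s esign_insert_left[OF A(2)] by (simp add: ac_simps)
      moreover have "esign {a} C * (x a * ?g A) = T2 a A"
        unfolding 2 T2_def s esign_insert_right[OF A(3)] sw by (simp add: ac_simps)
      ultimately show "esign {a} C * (x a * (?g (insert a A) + ?g A)) = T1 a A + T2 a A"
        by (simp only: distrib_left)
    qed
  qed
  have r1: "kprod (kdiff x u) v C = (\<Sum>A\<in>Pow C. \<Sum>a\<in>-C. T1 a A) + (\<Sum>A\<in>Pow C. \<Sum>a\<in>C - A. T1 a A)"
  proof -
    have "esign A (C - A) * (kdiff x u A * v (C - A)) = (\<Sum>a\<in>-C. T1 a A) + (\<Sum>a\<in>C - A. T1 a A)"
      if "A \<in> Pow C" for A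
    proof -
      have "-A = -C \<union> (C - A)" using that by auto
      then have "kdiff x u A = (\<Sum>a\<in>-C \<union> (C - A). esign {a} A * (x a * u (insert a A)))"
        by (simp add: kdiff_def)
      then have "esign A (C - A) * (kdiff x u A * v (C - A)) = (\<Sum>a\<in>-C \<union> (C - A). T1 a A)"
        by (simp add: T1_def sum_distrib_left sum_distrib_right ac_simps)
      also have "\<dots> = (\<Sum>a\<in>-C. T1 a A) + (\<Sum>a\<in>C - A. T1 a A)"
        by (intro sum.union_disjoint) auto
      finally show ?thesis .
    qed
    then show ?thesis unfolding kprod_def by (simp add: sum.distrib)
  qed
  have r2: "kprod (grade_sign u) (kdiff x v) C = (\<Sum>A\<in>Pow C. \<Sum>a\<in>-C. T2 a A) + (\<Sum>A\<in>Pow C. \<Sum>a\<in>A. T2 a A)"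
  proof -
    have "esign A (C - A) * (grade_sign u A * kdiff x v (C - A)) = (\<Sum>a\<in>-C. T2 a A) + (\<Sum>a\<in>A. T2 a A)"
      if "A \<in> Pow C" for A
    proof -
      have "-(C - A) = -C \<union> A" using that by auto
      then have "kdiff x v (C - A) = (\<Sum>a\<in>-C \<union> A. esign {a} (C - A) * (x a * v (insert a (C - A))))"
        by (simp add: kdiff_def)
      then have "esign A (C - A) * (grade_sign u A * kdiff x v (C - A)) = (\<Sum>a\<in>-C \<union> A. T2 a A)"
        by (simp add: T2_def grade_sign_def sum_distrib_left sum_distrib_right ac_simps)
      also have "\<dots> = (\<Sum>a\<in>-C. T2 a A) + (\<Sum>a\<in>A. T2 a A)"
        using that by (intro sum.union_disjoint) auto
      finally show ?thesis .
    qed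
    then show ?thesis unfolding kprod_def by (simp add: sum.distrib)
  qed
  have cancel: "(\<Sum>A\<in>Pow C. \<Sum>a\<in>C - A. T1 a A) = - (\<Sum>A\<in>Pow C. \<Sum>a\<in>A. T2 a A)"
  proof -
    have "(\<Sum>A\<in>Pow C. \<Sum>a\<in>C - A. T1 a A) = (\<Sum>(A, a)\<in>(SIGMA A:Pow C. C - A). T1 a A)"
      by (simp add: sum.Sigma)
    also have "\<dots> = (\<Sum>(A, a)\<in>(SIGMA A:Pow C. A). - T2 a A)"
    proof (rule sum.reindex_bij_witness[of _ "\<lambda>(A, a). (A - {a}, a)" "\<lambda>(A, a). (insert a A, a)"])
      fix p assume "p \<in> (SIGMA A:Pow C. C - A)"
      then obtain A a where p: "p = (A, a)" "A \<subseteq> C" "a \<in> C" "a \<notin> A" by auto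
      let ?D = "C - insert a A"
      have 1: "C - A = insert a ?D" "a \<notin> ?D" using p by auto
      have sw: "esign A {a} = esign {a} A * ((-1) ^ card A :: 'a)"
        using esign_swap[OF p(4)] esign_square_left[of "{a}" A "esign A {a}"] by metis
      show "(case (case p of (A, a) \<Rightarrow> (insert a A, a)) of (A, a) \<Rightarrow> - T2 a A) = (case p of (A, a) \<Rightarrow> T1 a A)"
        using p(4) unfolding p(1) prod.case T1_def T2_def 1(1) esign_insert_right[OF 1(2)]
          esign_insert_left[OF p(4)] sw
        by (simp add: ac_simps)
    qed auto
    also have "\<dots> = - (\<Sum>A\<in>Pow C. \<Sum>a\<in>A. T2 a A)"
      by (simp add: sum.Sigma[symmetric] sum_negf)
    finally show ?thesis .
  qed
  have "kdiff x (kprod u v) C = (\<Sum>a\<in>-C. \<Sum>A\<in>Pow C. T1 a A + T2 a A)"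
    unfolding kdiff_def using lhs by (intro sum.cong) auto
  also have "\<dots> = (\<Sum>A\<in>Pow C. \<Sum>a\<in>-C. T1 a A) + (\<Sum>A\<in>Pow C. \<Sum>a\<in>-C. T2 a A)"
    by (subst sum.swap) (simp add: sum.distrib)
  finally show ?thesis
    unfolding r1 r2 cancel by simp
qed

section \<open>A contracting homotopy in positive multidegree\<close>

definition unit_vec :: "'n \<Rightarrow> 'n \<Rightarrow>\<^sub>0 nat" where
  "unit_vec i = Poly_Mapping.single i 1"

lemma lookup_unit_vec: "Poly_Mapping.lookup (unit_vec i) j = (if j = i then 1 else 0)"
  by (simp add: unit_vec_def lookup_single when_def)

text \<open>
The exponent vector of the product of the variables in \<open>A\<close>. Giving \<open>e\<^sub>A\<close> the multidegree
\<open>set_vec A\<close> makes the Koszul differential homogeneous: \<open>x\<^sup>b e\<^sub>A\<close> has multidegree \<open>b + set_vec A\<close>.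
\<close>

definition set_vec :: "'n::finite set \<Rightarrow> 'n \<Rightarrow>\<^sub>0 nat" where
  "set_vec A = (\<Sum>i\<in>A. unit_vec i)"

abbreviation pvar :: "'n \<Rightarrow> ('n \<Rightarrow>\<^sub>0 nat) \<Rightarrow>\<^sub>0 'k::comm_ring_1" where
  "pvar i \<equiv> Poly_Mapping.single (unit_vec i) 1"

lemma lookup_set_vec: "Poly_Mapping.lookup (set_vec A) i = (if i \<in> A then 1 else 0)"
  by (simp add: set_vec_def lookup_sum lookup_unit_vec)

lemma set_vec_insert: "a \<notin> A \<Longrightarrow> set_vec (insert a A) = unit_vec a + set_vec A"
  by (simp add: set_vec_def)

lemma minus_unit_vec_plus:
  "Poly_Mapping.lookup b i > 0 \<Longrightarrow> b - unit_vec i + unit_vec i = b"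
  by (rule poly_mapping_eqI) (auto simp: lookup_add lookup_minus lookup_unit_vec)

lemma lookup_single_mult_plus:
  fixes f :: "('n \<Rightarrow>\<^sub>0 nat) \<Rightarrow>\<^sub>0 'k::comm_ring_1"
  shows "Poly_Mapping.lookup (Poly_Mapping.single a s * f) (a + b) = s * Poly_Mapping.lookup f b"
proof -
  have "Poly_Mapping.lookup (Poly_Mapping.single a s * f) (a + b) =
     Sum_any (\<lambda>l. Poly_Mapping.lookup (Poly_Mapping.single a s) l * Sum_any (\<lambda>q. Poly_Mapping.lookup f q when a + b = l + q))"
    by (simp add: lookup_mult)
  also have "\<dots> = Sum_any (\<lambda>l. s * Sum_any (\<lambda>q. Poly_Mapping.lookup f q when a + b = a + q) when l = a)"
    by (rule arg_cong[where f = Sum_any]) (auto simp: lookup_single when_def)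
  also have "\<dots> = s * Sum_any (\<lambda>q. Poly_Mapping.lookup f q when q = b)"
    by (simp add: eq_commute)
  finally show ?thesis by simp
qed

lemma lookup_pvar_mult:
  "Poly_Mapping.lookup (pvar i * f) b =
     (if Poly_Mapping.lookup b i > 0 then Poly_Mapping.lookup f (b - unit_vec i) else 0)"
proof (cases "Poly_Mapping.lookup b i > 0")
  case True
  then show ?thesis
    using lookup_single_mult_plus[of "unit_vec i" 1 f "b - unit_vec i"]
    by (simp only: minus_unit_vec_plus add.commute[of "unit_vec i"] if_True mult_1)
next
  case False
  have "b \<notin> Poly_Mapping.keys (pvar i * f)"
  proof
    assume "b \<in> Poly_Mapping.keys (pvar i * f)"
    then obtain c where "b = unit_vec i + c"
      using keys_mult[of "pvar i" f] by (auto split: if_splits)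
    then show False using False by (simp add: lookup_add lookup_unit_vec)
  qed
  then show ?thesis using False by (simp add: in_keys_iff)
qed

lemma lookup_esign_mult:
  "Poly_Mapping.lookup (esign A B * f) b = esign A B * Poly_Mapping.lookup f b"
  by (cases "even (inversions A B)") (simp_all add: esign_def)

lemma lookup_kdiff:
  "Poly_Mapping.lookup (kdiff pvar z B) b =
     (\<Sum>a\<in>{a \<in> -B. Poly_Mapping.lookup b a > 0}.
        esign {a} B * Poly_Mapping.lookup (z (insert a B)) (b - unit_vec a))"
proof -
  have "Poly_Mapping.lookup (kdiff pvar z B) b = (\<Sum>a\<in>-B. if Poly_Mapping.lookup b a > 0
      then esign {a} B * Poly_Mapping.lookup (z (insert a B)) (b - unit_vec a) else 0)"
    unfolding kdiff_def lookup_sum lookup_esign_mult lookup_pvar_mult by (intro sum.cong) auto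
  then show ?thesis
    by (subst sum.inter_filter) simp_all
qed

text \<open>
On the component of multidegree \<open>c\<close> with \<open>\<iota> c = Some i\<close> this is the linear map sending \<open>x\<^sup>b e\<^sub>A\<close> to
\<open>x\<^sup>b / x\<^sub>i\<close> times \<open>e\<^sub>i \<and> e\<^sub>A\<close> if \<open>x\<^sub>i\<close> divides \<open>x\<^sup>b\<close>, and to zero otherwise; where
\<open>\<iota> c\<close> is undefined it is zero. Up to scalars it is the de Rham differential in the single
variable \<open>x\<^sub>i\<close>. The freedom to choose \<open>i\<close> separately in each multidegree is what the proof
exploits.
\<close>

definition homotopy ::
  "(('n \<Rightarrow>\<^sub>0 nat) \<Rightarrow> 'n option) \<Rightarrow> ('n::{finite,linorder} set \<Rightarrow> ('n \<Rightarrow>\<^sub>0 nat) \<Rightarrow>\<^sub>0 'k::comm_ring_1)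
     \<Rightarrow> 'n set \<Rightarrow> ('n \<Rightarrow>\<^sub>0 nat) \<Rightarrow>\<^sub>0 'k" where
  "homotopy \<iota> z A = Abs_poly_mapping (\<lambda>b. case \<iota> (b + set_vec A) of None \<Rightarrow> 0 | Some i \<Rightarrow>
     if i \<in> A then esign {i} (A - {i}) * Poly_Mapping.lookup (z (A - {i})) (b + unit_vec i) else 0)"

lemma lookup_homotopy:
  "Poly_Mapping.lookup (homotopy \<iota> z A) b = (case \<iota> (b + set_vec A) of None \<Rightarrow> 0 | Some i \<Rightarrow>
     if i \<in> A then esign {i} (A - {i}) * Poly_Mapping.lookup (z (A - {i})) (b + unit_vec i) else 0)"
proof -
  let ?f = "\<lambda>b. case \<iota> (b + set_vec A) of None \<Rightarrow> 0 | Some i \<Rightarrow>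
     if i \<in> A then esign {i} (A - {i}) * Poly_Mapping.lookup (z (A - {i})) (b + unit_vec i) else 0"
  have "{b. ?f b \<noteq> 0} \<subseteq> (\<Union>i\<in>A. (\<lambda>b. b + unit_vec i) -` Poly_Mapping.keys (z (A - {i})))"
  proof
    fix b assume "b \<in> {b. ?f b \<noteq> 0}"
    then obtain i where "i \<in> A" "Poly_Mapping.lookup (z (A - {i})) (b + unit_vec i) \<noteq> 0"
      by (auto split: option.splits if_splits)
    then show "b \<in> (\<Union>i\<in>A. (\<lambda>b. b + unit_vec i) -` Poly_Mapping.keys (z (A - {i})))"
      by (auto simp: in_keys_iff)
  qed
  moreover have "finite (\<Union>i\<in>A. (\<lambda>b. b + unit_vec i) -` Poly_Mapping.keys (z (A - {i})))"
    by (intro finite_UN_I finite_vimageI) (auto simp: inj_def)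
  ultimately have "finite {b. ?f b \<noteq> 0}"
    by (rule finite_subset)
  then show ?thesis unfolding homotopy_def by simp
qed

text \<open>
In a multidegree \<open>c\<close> with chosen variable \<open>x\<^sub>i\<close>, the Koszul complex is the tensor product of the
acyclic strand \<open>k x\<^sub>i\<^sup>p\<^sup>-\<^sup>1 e\<^sub>i \<rightarrow> k x\<^sub>i\<^sup>p\<close> (with \<open>p = c\<^sub>i > 0\<close>) and the strand of the other
variables; the homotopy inverts the first factor. For \<open>i \<notin> B\<close> only the summand \<open>a = i\<close> of the
differential contributes. For \<open>i \<in> B\<close> the summands with \<open>a \<noteq> i\<close> of the two terms cancel because
\<open>e\<^sub>a\<close> and \<open>e\<^sub>i\<close> anticommute.
\<close>

lemma lookup_homotopy_identity:
  assumes pos: "\<And>c i. \<iota> c = Some i \<Longrightarrow> Poly_Mapping.lookup c i > 0"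
  shows "Poly_Mapping.lookup (kdiff pvar (homotopy \<iota> z) B) b
       + Poly_Mapping.lookup (homotopy \<iota> (kdiff pvar z) B) b =
       (if \<iota> (b + set_vec B) = None then 0 else Poly_Mapping.lookup (z B) b)"
proof -
  let ?T = "{a \<in> -B. Poly_Mapping.lookup b a > 0}"
  have deg: "b - unit_vec a + set_vec (insert a B) = b + set_vec B" if "a \<in> ?T" for a
    using that minus_unit_vec_plus[of b a] by (simp add: set_vec_insert flip: add.assoc)
  show ?thesis
  proof (cases "\<iota> (b + set_vec B)")
    case None
    then show ?thesis
      unfolding lookup_kdiff by (simp add: lookup_homotopy deg)
  next
    case (Some i)
    have hz: "Poly_Mapping.lookup (homotopy \<iota> z (insert a B)) (b - unit_vec a) =
       (if i \<in> insert a B then esign {i} (insert a B - {i}) *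
          Poly_Mapping.lookup (z (insert a B - {i})) (b - unit_vec a + unit_vec i) else 0)"
      if "a \<in> ?T" for a
      unfolding lookup_homotopy deg[OF that] Some by simp
    have hd: "Poly_Mapping.lookup (homotopy \<iota> (kdiff pvar z) B) b =
       (if i \<in> B then esign {i} (B - {i}) *
          Poly_Mapping.lookup (kdiff pvar z (B - {i})) (b + unit_vec i) else 0)"
      unfolding lookup_homotopy Some by simp
    have "Poly_Mapping.lookup (kdiff pvar (homotopy \<iota> z) B) b
       + Poly_Mapping.lookup (homotopy \<iota> (kdiff pvar z) B) b = Poly_Mapping.lookup (z B) b"
    proof (cases "i \<in> B")
      case False
      have bi: "Poly_Mapping.lookup b i > 0"
        using pos[OF Some] False by (simp add: lookup_add lookup_set_vec)
      have "Poly_Mapping.lookup (kdiff pvar (homotopy \<iota> z) B) b =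
            (\<Sum>a\<in>?T. if a = i then Poly_Mapping.lookup (z B) b else 0)"
        unfolding lookup_kdiff
      proof (intro sum.cong refl)
        fix a assume a: "a \<in> ?T"
        show "esign {a} B * Poly_Mapping.lookup (homotopy \<iota> z (insert a B)) (b - unit_vec a) =
            (if a = i then Poly_Mapping.lookup (z B) b else 0)"
          unfolding hz[OF a] using False a minus_unit_vec_plus[OF bi] by auto
      qed
      also have "\<dots> = Poly_Mapping.lookup (z B) b"
        using False bi by simp
      finally show ?thesis using False hd by simp
    next
      case True
      have set: "{a \<in> -(B - {i}). Poly_Mapping.lookup (b + unit_vec i) a > 0} = insert i ?T"
        using True by (auto simp: lookup_add lookup_unit_vec)
      have "Poly_Mapping.lookup (homotopy \<iota> (kdiff pvar z) B) b =
          esign {i} (B - {i}) * (\<Sum>a\<in>insert i ?T. esign {a} (B - {i}) *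
            Poly_Mapping.lookup (z (insert a (B - {i}))) (b + unit_vec i - unit_vec a))"
        using True unfolding hd lookup_kdiff set by simp
      also have "\<dots> = Poly_Mapping.lookup (z B) b + (\<Sum>a\<in>?T. esign {i} (B - {i}) * (esign {a} (B - {i}) *
            Poly_Mapping.lookup (z (insert a (B - {i}))) (b + unit_vec i - unit_vec a)))"
        using True by (simp add: distrib_left sum_distrib_left insert_absorb)
      also have "(\<Sum>a\<in>?T. esign {i} (B - {i}) * (esign {a} (B - {i}) *
            Poly_Mapping.lookup (z (insert a (B - {i}))) (b + unit_vec i - unit_vec a))) =
          - Poly_Mapping.lookup (kdiff pvar (homotopy \<iota> z) B) b"
        unfolding lookup_kdiff sum_negf[symmetric]
      proof (intro sum.cong refl)
        fix a assume a: "a \<in> ?T"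
        then have ai: "a \<noteq> i" "a \<notin> B" "a \<notin> B - {i}" "i \<notin> B - {i}" using True by auto
        have 1: "insert a B - {i} = insert a (B - {i})" and 2: "B = insert i (B - {i})"
          using ai True by auto
        have 3: "b - unit_vec a + unit_vec i = b + unit_vec i - unit_vec a"
          using a by (intro poly_mapping_eqI) (auto simp: lookup_add lookup_minus lookup_unit_vec)
        have s: "esign {a} B = esign {a} {i} * (esign {a} (B - {i}) :: 'b)"
          using esign_insert_right[OF ai(4), of "{a}"] 2 by simp
        show "esign {i} (B - {i}) * (esign {a} (B - {i}) *
            Poly_Mapping.lookup (z (insert a (B - {i}))) (b + unit_vec i - unit_vec a)) =
          - (esign {a} B * Poly_Mapping.lookup (homotopy \<iota> z (insert a B)) (b - unit_vec a))"
          unfolding hz[OF a] s 1 3 esign_insert_right[OF ai(3)] esign_anticommute[OF ai(1)]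
          using True by (simp add: ac_simps)
      qed
      finally show ?thesis by simp
    qed
    then show ?thesis by (simp add: Some)
  qed
qed

section \<open>Products of cycles modulo a monomial ideal\<close>

text \<open>
If \<open>E\<close> is the set of exponents of the monomials in a monomial ideal \<open>L\<close>, this says that all
coefficients of the chain \<open>z\<close> lie in \<open>L\<close>.
\<close>

definition coeffs_in ::
  "('n \<Rightarrow>\<^sub>0 nat) set \<Rightarrow> ('n set \<Rightarrow> ('n \<Rightarrow>\<^sub>0 nat) \<Rightarrow>\<^sub>0 'k::zero) \<Rightarrow> bool" where
  "coeffs_in E z \<longleftrightarrow> (\<forall>A. Poly_Mapping.keys (z A) \<subseteq> E)"

lemma coeffs_inD: "coeffs_in E z \<Longrightarrow> Poly_Mapping.lookup (z A) b \<noteq> 0 \<Longrightarrow> b \<in> E"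
  by (meson coeffs_in_def in_keys_iff subsetD)

lemma keys_esign_mult_subset: "Poly_Mapping.keys (esign A B * f) \<subseteq> Poly_Mapping.keys f"
  by (auto simp: in_keys_iff lookup_esign_mult)

lemma coeffs_in_mono: "coeffs_in E z \<Longrightarrow> E \<subseteq> F \<Longrightarrow> coeffs_in F z"
  by (auto simp: coeffs_in_def)

lemma coeffs_in_UNIV [simp]: "coeffs_in UNIV z"
  by (simp add: coeffs_in_def)

lemma coeffs_in_add:
  assumes "coeffs_in E y" "coeffs_in E z"
  shows "coeffs_in E (\<lambda>A. y A + z A)"
  unfolding coeffs_in_def
proof
  fix A
  show "Poly_Mapping.keys (y A + z A) \<subseteq> E"
    using keys_add[of "y A" "z A"] assms unfolding coeffs_in_def by blast
qed

lemma coeffs_in_uminus: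
  fixes z :: "'n set \<Rightarrow> ('n \<Rightarrow>\<^sub>0 nat) \<Rightarrow>\<^sub>0 'k::comm_ring_1"
  assumes "coeffs_in E z"
  shows "coeffs_in E (\<lambda>A. - z A)"
proof -
  have "Poly_Mapping.keys (- z A) = Poly_Mapping.keys (z A)" for A
    by (auto simp only: in_keys_iff lookup_uminus neg_equal_0_iff_equal)
  then show ?thesis using assms unfolding coeffs_in_def by metis
qed

lemma coeffs_in_minus:
  fixes y z :: "'n set \<Rightarrow> ('n \<Rightarrow>\<^sub>0 nat) \<Rightarrow>\<^sub>0 'k::comm_ring_1"
  assumes "coeffs_in E y" "coeffs_in E z"
  shows "coeffs_in E (\<lambda>A. y A - z A)"
  using coeffs_in_add[OF assms(1) coeffs_in_uminus[OF assms(2)]] by simp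

lemma coeffs_in_grade_sign:
  assumes "coeffs_in E z"
  shows "coeffs_in E (grade_sign z)"
  unfolding coeffs_in_def
proof
  fix A
  consider "grade_sign z A = z A" | "grade_sign z A = - z A"
    by (cases "even (card A)") (simp_all add: grade_sign_def)
  then show "Poly_Mapping.keys (grade_sign z A) \<subseteq> E"
    using assms coeffs_in_uminus[OF assms] unfolding coeffs_in_def by cases metis+
qed

lemma coeffs_in_kprod:
  assumes "coeffs_in E u" "coeffs_in F v"
  shows "coeffs_in {a + b | a b. a \<in> E \<and> b \<in> F} (kprod u v)"
  unfolding coeffs_in_def
proof (intro allI subsetI)
  fix C c assume "c \<in> Poly_Mapping.keys (kprod u v C)"
  then obtain A where "c \<in> Poly_Mapping.keys (esign A (C - A) * (u A * v (C - A)))"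
    using keys_sum[of "\<lambda>A. esign A (C - A) * (u A * v (C - A))" "Pow C"]
    unfolding kprod_def by (auto dest: subsetD)
  then have "c \<in> Poly_Mapping.keys (u A * v (C - A))"
    by (rule subsetD[OF keys_esign_mult_subset])
  then have "c \<in> {a + b | a b. a \<in> Poly_Mapping.keys (u A) \<and> b \<in> Poly_Mapping.keys (v (C - A))}"
    by (rule subsetD[OF keys_mult])
  then obtain a b where "c = a + b" "a \<in> Poly_Mapping.keys (u A)" "b \<in> Poly_Mapping.keys (v (C - A))"
    by blast
  then show "c \<in> {a + b | a b. a \<in> E \<and> b \<in> F}"
    using coeffs_inD[OF assms(1)] coeffs_inD[OF assms(2)] unfolding in_keys_iff by blast
qed

definition up_closed :: "('n \<Rightarrow>\<^sub>0 nat) set \<Rightarrow> bool" where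
  "up_closed E \<longleftrightarrow> (\<forall>a\<in>E. \<forall>c. a + c \<in> E)"

lemma up_closedD:
  assumes "up_closed E" "a \<in> E"
  shows "a + c \<in> E" "c + a \<in> E"
  using assms add.commute[of c a] unfolding up_closed_def by auto

lemma coeffs_in_kprod_left:
  assumes "up_closed E" "coeffs_in E u"
  shows "coeffs_in E (kprod u v)"
  using coeffs_in_kprod[OF assms(2) coeffs_in_UNIV]
  by (rule coeffs_in_mono) (use up_closedD(1)[OF assms(1)] in blast)

lemma coeffs_in_kprod_right:
  assumes "up_closed E" "coeffs_in E v"
  shows "coeffs_in E (kprod u v)"
  using coeffs_in_kprod[OF coeffs_in_UNIV assms(2)]
  by (rule coeffs_in_mono) (use up_closedD(2)[OF assms(1)] in blast)

text \<open>
In characteristic zero, the exponents of \<open>\<partial>(I)\<close>, if \<open>E\<close> are those of \<open>I\<close>.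
\<close>

definition deriv_exponents :: "('n \<Rightarrow>\<^sub>0 nat) set \<Rightarrow> ('n \<Rightarrow>\<^sub>0 nat) set" where
  "deriv_exponents E = {a. \<exists>i. a + unit_vec i \<in> E}"

text \<open>
The homotopy divides each coefficient by at most one variable.
\<close>

lemma coeffs_in_homotopy:
  assumes "coeffs_in E z"
  shows "coeffs_in (deriv_exponents E) (homotopy \<iota> z)"
  unfolding coeffs_in_def
proof (intro allI subsetI)
  fix A b assume "b \<in> Poly_Mapping.keys (homotopy \<iota> z A)"
  then obtain i where "Poly_Mapping.lookup (z (A - {i})) (b + unit_vec i) \<noteq> 0"
    by (auto simp: in_keys_iff lookup_homotopy split: option.splits if_splits)
  then show "b \<in> deriv_exponents E"
    using coeffs_inD[OF assms] by (auto simp: deriv_exponents_def)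
qed

text \<open>
The heart of the matter, stated for exponents: \<open>E\<close> plays the role of the monomials of \<open>I\<close>, and \<open>\<mu>\<close>
that of the exponent of \<open>lcm(I)\<close>. The chains \<open>u\<close> and \<open>v\<close> are lifts of cycles modulo \<open>I\<close>.

The homotopy \<open>h\<close> that uses any variable of positive degree replaces \<open>u\<close> by \<open>u' = h \<partial>u\<close>
modulo boundaries, and the coefficients of \<open>u'\<close> lie in \<open>\<partial>(I)\<close>; likewise for \<open>v\<close>. By the
Leibniz rule \<open>u v\<close> agrees with \<open>p = u' v'\<close> up to boundaries and chains over \<open>I\<close>. In multidegrees
bounded by \<open>\<mu>\<close> the coefficients of \<open>p\<close> are in \<open>I\<close> by \<open>sq\<close>. In a multidegree \<open>c\<close> with
\<open>c\<^sub>i > \<mu>\<^sub>i\<close> for some \<open>i\<close>, the homotopy for such an \<open>i\<close> preserves the chains over \<open>I\<close>, by \<open>bound\<close>: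
dividing a monomial of \<open>I\<close> by \<open>x\<^sub>i\<close> does not leave \<open>I\<close> as long as the quotient has
exponent at least \<open>\<mu>\<^sub>i\<close>. So there the cycle \<open>p\<close> is a boundary modulo \<open>I\<close>.
\<close>

theorem kprod_boundary_modulo:
  fixes u v :: "'n::{finite,linorder} set \<Rightarrow> ('n \<Rightarrow>\<^sub>0 nat) \<Rightarrow>\<^sub>0 'k::comm_ring_1"
    and \<mu> :: "'n \<Rightarrow> nat"
  assumes up: "up_closed E"
    and sq: "\<And>a b. a \<in> deriv_exponents E \<Longrightarrow> b \<in> deriv_exponents E \<Longrightarrow>
        (\<And>i. Poly_Mapping.lookup (a + b) i \<le> \<mu> i) \<Longrightarrow> a + b \<in> E"
    and bound: "\<And>a i. a + unit_vec i \<in> E \<Longrightarrow> \<mu> i \<le> Poly_Mapping.lookup a i \<Longrightarrow> a \<in> E"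
    and u: "coeffs_in E (kdiff pvar u)" "Poly_Mapping.lookup (u {}) 0 = 0"
    and v: "coeffs_in E (kdiff pvar v)" "Poly_Mapping.lookup (v {}) 0 = 0"
  shows "\<exists>w. coeffs_in E (\<lambda>A. kprod u v A - kdiff pvar w A)"
proof -
  define \<iota> where "\<iota> c = (if c = 0 then None else Some (SOME i. Poly_Mapping.lookup c i > 0))"
    for c :: "'n \<Rightarrow>\<^sub>0 nat"
  define h :: "('n set \<Rightarrow> ('n \<Rightarrow>\<^sub>0 nat) \<Rightarrow>\<^sub>0 'k) \<Rightarrow> _" where "h = homotopy \<iota>"
  have \<iota>: "Poly_Mapping.lookup c i > 0" if "\<iota> c = Some i" for c i
  proof -
    have "\<exists>i. Poly_Mapping.lookup c i > 0"
      using that by (auto simp: \<iota>_def poly_mapping_eq_iff fun_eq_iff split: if_splits)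
    then have "Poly_Mapping.lookup c (SOME i. Poly_Mapping.lookup c i > 0) > 0"
      by (rule someI_ex)
    then show ?thesis using that by (auto simp: \<iota>_def split: if_splits)
  qed
  \<comment> \<open>Multidegree zero, the only one without a variable to choose, occurs in the constant term
    of the coefficient of \<open>e\<^bsub>{}\<^esub> = 1\<close> alone.\<close>
  have split: "z = (\<lambda>A. kdiff pvar (h z) A + h (kdiff pvar z) A)"
    if "Poly_Mapping.lookup (z {}) 0 = 0" for z
  proof (intro ext poly_mapping_eqI)
    fix B b
    have "Poly_Mapping.lookup (z B) b = 0" if "\<iota> (b + set_vec B) = None"
    proof -
      have zero: "b + set_vec B = 0" using that by (auto simp: \<iota>_def split: if_splits)
      have "Poly_Mapping.lookup b i = 0 \<and> i \<notin> B" for i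
        using arg_cong[OF zero, of "\<lambda>c. Poly_Mapping.lookup c i"]
        by (auto simp: lookup_add lookup_set_vec split: if_splits)
      then have "b = 0" "B = {}" by (auto intro: poly_mapping_eqI)
      then show ?thesis using \<open>Poly_Mapping.lookup (z {}) 0 = 0\<close> by simp
    qed
    then show "Poly_Mapping.lookup (z B) b =
        Poly_Mapping.lookup (kdiff pvar (h z) B + h (kdiff pvar z) B) b"
      using lookup_homotopy_identity[of \<iota> z B b] \<iota> by (simp add: lookup_add h_def split: if_splits)
  qed
  define u' v' where "u' = h (kdiff pvar u)" and "v' = h (kdiff pvar v)"
  have u_eq: "u = (\<lambda>A. kdiff pvar (h u) A + u' A)" and v_eq: "v = (\<lambda>A. kdiff pvar (h v) A + v' A)"
    unfolding u'_def v'_def using split[of u] split[of v] u(2) v(2) by blast+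
  have du': "kdiff pvar u' = kdiff pvar u" and dv': "kdiff pvar v' = kdiff pvar v"
    using arg_cong[OF u_eq, of "kdiff pvar"] arg_cong[OF v_eq, of "kdiff pvar"]
    by (simp_all add: fun_eq_iff kdiff_add kdiff_kdiff)
  define p where "p = kprod u' v'"
  have p_coeffs: "coeffs_in {a + b | a b. a \<in> deriv_exponents E \<and> b \<in> deriv_exponents E} p"
    unfolding p_def u'_def v'_def h_def by (intro coeffs_in_kprod coeffs_in_homotopy u v)
  have dp: "coeffs_in E (kdiff pvar p)"
    unfolding p_def kdiff_kprod[abs_def] du' dv'
    by (intro coeffs_in_add coeffs_in_kprod_left coeffs_in_kprod_right up u v)
  \<comment> \<open>The second homotopy is switched on only in the multidegrees not bounded by \<open>\<mu>\<close>, so that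
    subtracting \<open>\<partial>q\<close> leaves the components of \<open>p\<close> in the other multidegrees unchanged.\<close>
  define \<kappa> where "\<kappa> c = (if \<exists>i. Poly_Mapping.lookup c i > \<mu> i
      then Some (SOME i. Poly_Mapping.lookup c i > \<mu> i) else None)" for c :: "'n \<Rightarrow>\<^sub>0 nat"
  have \<kappa>: "Poly_Mapping.lookup c i > \<mu> i" if "\<kappa> c = Some i" for c i
    using that someI_ex[of "\<lambda>i. Poly_Mapping.lookup c i > \<mu> i"] by (auto simp: \<kappa>_def split: if_splits)
  have \<kappa>_None: "Poly_Mapping.lookup c i \<le> \<mu> i" if "\<kappa> c = None" for c i
    using that by (auto simp: \<kappa>_def not_less split: if_splits)
  define q where "q = homotopy \<kappa> p"
  have pq: "coeffs_in E (\<lambda>A. p A - kdiff pvar q A)"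
    unfolding coeffs_in_def
  proof (intro allI subsetI)
    fix B b assume b: "b \<in> Poly_Mapping.keys (p B - kdiff pvar q B)"
    have pos: "Poly_Mapping.lookup c i > 0" if "\<kappa> c = Some i" for c i
      using \<kappa>[OF that] by simp
    note id = lookup_homotopy_identity[of \<kappa> p B b, OF pos]
    show "b \<in> E"
    proof (cases "\<kappa> (b + set_vec B)")
      case None
      have "b \<in> Poly_Mapping.keys (p B)"
        using b id None by (simp add: q_def in_keys_iff lookup_minus lookup_homotopy)
      then obtain a a' where "b = a + a'" "a \<in> deriv_exponents E" "a' \<in> deriv_exponents E"
        using p_coeffs unfolding coeffs_in_def by blast
      moreover have "Poly_Mapping.lookup b i \<le> \<mu> i" for i
        using \<kappa>_None[OF None, of i] by (simp add: lookup_add)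
      ultimately show ?thesis using sq by blast
    next
      case (Some i)
      have "Poly_Mapping.lookup (homotopy \<kappa> (kdiff pvar p) B) b =
          Poly_Mapping.lookup (p B - kdiff pvar q B) b"
        using id Some by (simp add: q_def lookup_minus algebra_simps)
      then have "Poly_Mapping.lookup (homotopy \<kappa> (kdiff pvar p) B) b \<noteq> 0"
        using b by (simp add: in_keys_iff)
      then have "i \<in> B" "Poly_Mapping.lookup (kdiff pvar p (B - {i})) (b + unit_vec i) \<noteq> 0"
        by (auto simp: lookup_homotopy Some split: if_splits)
      moreover have "\<mu> i < Poly_Mapping.lookup b i + 1"
        using \<kappa>[OF Some] \<open>i \<in> B\<close> by (simp add: lookup_add lookup_set_vec)
      ultimately show ?thesis
        using coeffs_inD[OF dp] by (intro bound[of b i]) auto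
    qed
  qed
  \<comment> \<open>The Leibniz rule, applied to \<open>(h u) v\<close> and to \<open>u' (h v)\<close> with its left factor twisted by the
    grading sign, turns the first two of the three terms of \<open>u v\<close> into boundaries up to \<open>r\<close>.\<close>
  define w where "w A = kprod (h u) v A + kprod (grade_sign u') (h v) A + q A" for A
  define r where "r A = kprod (grade_sign (kdiff pvar u)) (h v) A
      - kprod (grade_sign (h u)) (kdiff pvar v) A" for A
  have "kprod u v A - kdiff pvar w A = r A + (p A - kdiff pvar q A)" for A
  proof -
    have "kprod u v A = kprod (kdiff pvar (h u)) v A + kprod u' v A"
      by (subst (1) u_eq) (rule kprod_add_left)
    also have "kprod u' v A = kprod u' (kdiff pvar (h v)) A + p A"
      unfolding p_def by (subst (1) v_eq) (rule kprod_add_right)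
    finally have uv: "kprod u v A = kprod (kdiff pvar (h u)) v A + (kprod u' (kdiff pvar (h v)) A + p A)" .
    have "kprod (\<lambda>B. - grade_sign (kdiff pvar u) B) (h v) A
        = - kprod (grade_sign (kdiff pvar u)) (h v) A"
      by (simp add: kprod_def sum_negf)
    then have "kdiff pvar w A = kprod (kdiff pvar (h u)) v A + kprod (grade_sign (h u)) (kdiff pvar v) A
      + (- kprod (grade_sign (kdiff pvar u)) (h v) A + kprod u' (kdiff pvar (h v)) A) + kdiff pvar q A"
      unfolding w_def kdiff_add kdiff_kprod kdiff_grade_sign du' grade_sign_grade_sign by simp
    then show ?thesis unfolding uv r_def by simp
  qed
  moreover have "coeffs_in E r"
    unfolding r_def[abs_def]
    by (intro coeffs_in_minus coeffs_in_kprod_left coeffs_in_kprod_right coeffs_in_grade_sign up u v)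
  ultimately have "coeffs_in E (\<lambda>A. kprod u v A - kdiff pvar w A)"
    using coeffs_in_add[OF _ pq, of r] by simp
  then show ?thesis by blast
qed

section \<open>Monomial ideals and their exponent sets\<close>

lemma mpoly_ring_simps [simp]:
  "carrier mpoly_ring = UNIV" "x \<otimes>\<^bsub>mpoly_ring\<^esub> y = x * y" "\<one>\<^bsub>mpoly_ring\<^esub> = 1"
  "\<zero>\<^bsub>mpoly_ring\<^esub> = 0" "x \<oplus>\<^bsub>mpoly_ring\<^esub> y = x + y"
  by (simp_all add: mpoly_ring_def ring_of_type_algebra_def)

lemma cring_mpoly_ring: "cring mpoly_ring"
  unfolding mpoly_ring_def by (rule cring_from_type_algebra)

lemma ring_mpoly_ring: "ring mpoly_ring"
  using cring_mpoly_ring by (rule cring.axioms(1))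

lemma mpoly_ring_a_inv [simp]: "\<ominus>\<^bsub>mpoly_ring\<^esub> x = - x"
proof -
  interpret cring mpoly_ring by (rule cring_mpoly_ring)
  have "(- x) \<oplus>\<^bsub>mpoly_ring\<^esub> x = \<zero>\<^bsub>mpoly_ring\<^esub>" by simp
  then show ?thesis
    by (intro minus_equality) simp_all
qed

lemma ideal_genideal_mpoly_ring: "ideal (Idl\<^bsub>mpoly_ring\<^esub> M) mpoly_ring"
  by (rule ring.genideal_ideal[OF ring_mpoly_ring]) simp

lemma genideal_self_mpoly_ring: "M \<subseteq> Idl\<^bsub>mpoly_ring\<^esub> M"
  by (rule ring.genideal_self[OF ring_mpoly_ring]) simp

lemma ideal_multI: "ideal I mpoly_ring \<Longrightarrow> f \<in> I \<Longrightarrow> g * f \<in> I"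
  using ideal.I_l_closed[of I mpoly_ring f g] by simp

lemma ideal_addI: "ideal I mpoly_ring \<Longrightarrow> f \<in> I \<Longrightarrow> g \<in> I \<Longrightarrow> f + g \<in> I"
  using additive_subgroup.a_closed[OF ideal.axioms(1), of I mpoly_ring f g] by simp

lemma ideal_sumI:
  assumes "ideal I mpoly_ring" "\<And>x. x \<in> Y \<Longrightarrow> f x \<in> I"
  shows "(\<Sum>x\<in>Y. f x) \<in> I"
  using assms(2)
proof (induction Y rule: infinite_finite_induct)
  case (insert x Y)
  then show ?case using ideal_addI[OF assms(1)] by simp
qed (use additive_subgroup.zero_closed[OF ideal.axioms(1)[OF assms(1)]] in simp_all)

definition exponents :: "('n::finite, 'k::field) mpoly set \<Rightarrow> ('n \<Rightarrow>\<^sub>0 nat) set" where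
  "exponents I = {a. monomial a \<in> I}"

lemma monomial_mult: "monomial a * monomial b = monomial (a + b)"
  by (simp add: monomial_def mult_single)

lemma monomial_inj: "monomial a = monomial b \<longleftrightarrow> a = b"
  by (metis keys_single monomial_def singleton_inject zero_neq_one)

lemma up_closed_exponents: "ideal I mpoly_ring \<Longrightarrow> up_closed (exponents I)"
  unfolding up_closed_def exponents_def
  using ideal_multI monomial_mult by (metis add.commute mem_Collect_eq)

lemma sum_single_keys: "(\<Sum>a\<in>Poly_Mapping.keys f. Poly_Mapping.single a (Poly_Mapping.lookup f a)) = f"
  by (rule poly_mapping_eqI) (simp add: lookup_sum lookup_single when_def in_keys_iff)

lemma single_in_idealI:
  assumes "ideal I mpoly_ring" "a \<in> exponents I"
  shows "Poly_Mapping.single a c \<in> I"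
proof -
  have "Poly_Mapping.single 0 c * monomial a = Poly_Mapping.single a c"
    by (simp add: monomial_def mult_single)
  then show ?thesis
    using ideal_multI[OF assms(1), of "monomial a" "Poly_Mapping.single 0 c"] assms(2)
    by (simp add: exponents_def)
qed

lemma keys_subset_exponents_imp_mem:
  assumes "ideal I mpoly_ring" "Poly_Mapping.keys f \<subseteq> exponents I"
  shows "f \<in> I"
proof -
  have "(\<Sum>a\<in>Poly_Mapping.keys f. Poly_Mapping.single a (Poly_Mapping.lookup f a)) \<in> I"
    using assms by (intro ideal_sumI single_in_idealI) auto
  then show ?thesis by (simp only: sum_single_keys)
qed

lemma ideal_keys_subset:
  assumes "up_closed E"
  shows "ideal {f. Poly_Mapping.keys f \<subseteq> E} (mpoly_ring :: ('n::finite, 'k::field) mpoly ring)"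
    (is "ideal ?J ?R")
proof (rule idealI)
  show "ring ?R" by (rule ring_mpoly_ring)
  have mult: "g * f \<in> ?J" if "f \<in> ?J" for f g :: "('n, 'k) mpoly"
  proof -
    have "c \<in> E" if "c \<in> Poly_Mapping.keys (g * f)" for c
      using subsetD[OF keys_mult that] \<open>f \<in> ?J\<close> up_closedD(2)[OF assms] by blast
    then show ?thesis by blast
  qed
  then show "x \<otimes>\<^bsub>?R\<^esub> f \<in> ?J" "f \<otimes>\<^bsub>?R\<^esub> x \<in> ?J" if "f \<in> ?J" for f x
    using that by (simp_all add: mult.commute)
  have neg: "- f \<in> ?J" if "f \<in> ?J" for f :: "('n, 'k) mpoly"
    using mult[OF that, of "- 1"] by simp
  have add: "f + g \<in> ?J" if "f \<in> ?J" "g \<in> ?J" for f g :: "('n, 'k) mpoly"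
    using keys_add[of f g] that by blast
  show "subgroup ?J (add_monoid ?R)"
  proof (rule group.subgroupI)
    show "group (add_monoid ?R)"
      using abelian_group.a_group ring.is_abelian_group ring_mpoly_ring by blast
    show "inv\<^bsub>add_monoid ?R\<^esub> f \<in> ?J" if "f \<in> ?J" for f
      using neg[OF that] mpoly_ring_a_inv[of f] by (simp add: a_inv_def)
    show "?J \<noteq> {}" by (auto intro: exI[of _ 0])
    show "f \<otimes>\<^bsub>add_monoid ?R\<^esub> g \<in> ?J" if "f \<in> ?J" "g \<in> ?J" for f g
      using add[OF that] by simp
  qed simp
qed

lemma monomial_ideal_imp_ideal: "monomial_ideal I \<Longrightarrow> ideal I mpoly_ring"
  unfolding monomial_ideal_def using ideal_genideal_mpoly_ring by blast

text \<open>
The polynomials all of whose monomials lie in \<open>I\<close> form an ideal, which contains the generators.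
\<close>

lemma monomial_ideal_mem_iff:
  assumes "monomial_ideal I"
  shows "f \<in> I \<longleftrightarrow> Poly_Mapping.keys f \<subseteq> exponents I"
proof
  have I: "ideal I mpoly_ring" using assms by (rule monomial_ideal_imp_ideal)
  show "Poly_Mapping.keys f \<subseteq> exponents I \<Longrightarrow> f \<in> I"
    using I by (rule keys_subset_exponents_imp_mem)
  obtain M where M: "M \<subseteq> monomials" "I = Idl\<^bsub>mpoly_ring\<^esub> M"
    using assms unfolding monomial_ideal_def by blast
  have "M \<subseteq> {f. Poly_Mapping.keys f \<subseteq> exponents I}"
  proof
    fix g assume g: "g \<in> M"
    then obtain a where "g = monomial a" using M(1) by (auto simp: monomials_def)
    moreover have "g \<in> I" using g M(2) genideal_self_mpoly_ring by blast
    ultimately show "g \<in> {f. Poly_Mapping.keys f \<subseteq> exponents I}"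
      by (auto simp: monomial_def exponents_def)
  qed
  then have "I \<subseteq> {f. Poly_Mapping.keys f \<subseteq> exponents I}"
    unfolding M(2) by (intro ring.genideal_minimal[OF ring_mpoly_ring] ideal_keys_subset
        up_closed_exponents ideal_genideal_mpoly_ring) simp
  then show "f \<in> I \<Longrightarrow> Poly_Mapping.keys f \<subseteq> exponents I" by blast
qed

section \<open>The least common multiple of the minimal generators\<close>

definition divides_exp :: "('n \<Rightarrow>\<^sub>0 nat) \<Rightarrow> ('n \<Rightarrow>\<^sub>0 nat) \<Rightarrow> bool" where
  "divides_exp a b \<longleftrightarrow> (\<forall>i. Poly_Mapping.lookup a i \<le> Poly_Mapping.lookup b i)"

lemma divides_exp_iff_add: "divides_exp a b \<longleftrightarrow> (\<exists>c. b = a + c)"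
proof
  assume "divides_exp a b"
  then have "b = a + (b - a)"
    by (intro poly_mapping_eqI) (simp add: lookup_add lookup_minus divides_exp_def)
  then show "\<exists>c. b = a + c" by blast
qed (auto simp: divides_exp_def lookup_add)

lemma divides_exp_antisym: "divides_exp a b \<Longrightarrow> divides_exp b a \<Longrightarrow> a = b"
  by (rule poly_mapping_eqI) (simp add: divides_exp_def order_antisym)

lemma monomial_dvd_iff: "monomial a dvd monomial b \<longleftrightarrow> divides_exp a b"
proof
  assume "monomial a dvd (monomial b :: ('a, 'b) mpoly)"
  then obtain g :: "('a, 'b) mpoly" where g: "monomial b = monomial a * g" by (rule dvdE)
  have "b \<in> Poly_Mapping.keys (monomial b :: ('a, 'b) mpoly)"
    by (simp add: monomial_def)
  then have "b \<in> Poly_Mapping.keys (monomial a * g)"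
    by (simp only: g)
  then have "b \<in> {x + y | x y. x \<in> Poly_Mapping.keys (monomial a :: ('a, 'b) mpoly) \<and> y \<in> Poly_Mapping.keys g}"
    by (rule subsetD[OF keys_mult])
  then show "divides_exp a b"
    by (auto simp: monomial_def divides_exp_iff_add)
next
  assume "divides_exp a b"
  then show "monomial a dvd (monomial b :: ('a, 'b) mpoly)"
    by (auto simp: divides_exp_iff_add monomial_mult[symmetric])
qed

text \<open>
A monotone subsequence that decreases is constant from the place of its least value on.
\<close>

lemma nat_seq_incseq_subseq:
  fixes s :: "nat \<Rightarrow> nat"
  shows "\<exists>r. strict_mono r \<and> incseq (\<lambda>n. s (r n))"
proof -
  obtain r where r: "strict_mono r" "monoseq (\<lambda>n. s (r n))"
    using seq_monosub by blast
  show ?thesis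
  proof (cases "incseq (\<lambda>n. s (r n))")
    case False
    then have dec: "decseq (\<lambda>n. s (r n))"
      using r(2) by (simp add: monoseq_iff)
    obtain n0 where n0: "s (r n0) \<le> s (r n)" for n
      using ex_has_least_nat[of "\<lambda>_. True" 0 "\<lambda>n. s (r n)"] by auto
    have "s (r (n0 + n)) = s (r n0)" for n
      using decseqD[OF dec, of n0 "n0 + n"] n0[of "n0 + n"] by simp
    then have "incseq (\<lambda>n. s (r (n0 + n)))" by (simp add: incseq_def)
    moreover have "strict_mono (\<lambda>n. r (n0 + n))"
      using r(1) by (simp add: strict_mono_def)
    ultimately show ?thesis by blast
  qed (use r in blast)
qed

lemma exponent_seq_incseq_subseq:
  fixes s :: "nat \<Rightarrow> 'n \<Rightarrow>\<^sub>0 nat"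
  assumes "finite Y"
  shows "\<exists>r. strict_mono r \<and> (\<forall>i\<in>Y. incseq (\<lambda>n. Poly_Mapping.lookup (s (r n)) i))"
  using assms
proof (induction Y)
  case empty
  show ?case by (rule exI[of _ id]) (simp add: strict_mono_def)
next
  case (insert i Y)
  then obtain r where r: "strict_mono r" "\<forall>j\<in>Y. incseq (\<lambda>n. Poly_Mapping.lookup (s (r n)) j)"
    by blast
  obtain t where t: "strict_mono t" "incseq (\<lambda>n. Poly_Mapping.lookup (s (r (t n))) i)"
    using nat_seq_incseq_subseq[of "\<lambda>n. Poly_Mapping.lookup (s (r n)) i"] by blast
  have "strict_mono (\<lambda>n. r (t n))" using r(1) t(1) by (simp add: strict_mono_def)
  moreover have "incseq (\<lambda>n. Poly_Mapping.lookup (s (r (t n))) j)" if "j \<in> Y" for j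
    using r(2) that t(1) by (auto simp: incseq_def strict_mono_less_eq)
  ultimately show ?case using t(2) by (intro exI[of _ "\<lambda>n. r (t n)"]) auto
qed

text \<open>
Dickson's lemma: any sequence of exponent vectors has a subsequence that increases in every
coordinate. It guarantees that the least common multiple of the minimal generators exists.
\<close>

lemma finite_antichain_exponents:
  fixes E :: "('n::finite \<Rightarrow>\<^sub>0 nat) set"
  assumes anti: "\<And>a b. a \<in> E \<Longrightarrow> b \<in> E \<Longrightarrow> divides_exp a b \<Longrightarrow> a = b"
  shows "finite E"
proof (rule ccontr)
  assume "infinite E"
  then obtain s :: "nat \<Rightarrow> _" where s: "inj s" "range s \<subseteq> E"
    using infinite_countable_subset by blast
  obtain r where r: "strict_mono r" "\<forall>i\<in>UNIV. incseq (\<lambda>n. Poly_Mapping.lookup (s (r n)) i)"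
    using exponent_seq_incseq_subseq[of UNIV s] by auto
  have "divides_exp (s (r 0)) (s (r 1))"
    using r(2) by (simp add: divides_exp_def incseq_def)
  then have "s (r 0) = s (r 1)" using anti s(2) by blast
  then show False
    using s(1) r(1) by (metis injD strict_mono_eq zero_neq_one)
qed

definition min_exponents :: "('n \<Rightarrow>\<^sub>0 nat) set \<Rightarrow> ('n \<Rightarrow>\<^sub>0 nat) set" where
  "min_exponents E = {a \<in> E. \<forall>b\<in>E. divides_exp b a \<longrightarrow> b = a}"

lemma finite_min_exponents: "finite (min_exponents (E :: ('n::finite \<Rightarrow>\<^sub>0 nat) set))"
  by (rule finite_antichain_exponents) (auto simp: min_exponents_def)

text \<open>
Among the members of \<open>E\<close> below \<open>a\<close>, one of least total degree is minimal.
\<close>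

lemma min_exponent_below:
  fixes E :: "('n::finite \<Rightarrow>\<^sub>0 nat) set"
  assumes "a \<in> E"
  obtains b where "b \<in> min_exponents E" "divides_exp b a"
proof -
  let ?size = "\<lambda>b :: 'n \<Rightarrow>\<^sub>0 nat. \<Sum>i\<in>UNIV. Poly_Mapping.lookup b i"
  let ?P = "\<lambda>b. b \<in> E \<and> divides_exp b a"
  have "?P a" using assms by (simp add: divides_exp_def)
  then obtain b where b: "?P b" "\<And>c. ?P c \<Longrightarrow> ?size b \<le> ?size c"
    using ex_has_least_nat[of ?P a ?size] by blast
  have "c = b" if c: "c \<in> E" "divides_exp c b" for c
  proof -
    have "divides_exp c a" using c(2) b(1) by (auto simp: divides_exp_def intro: order_trans)
    then have "?size b \<le> ?size c" using b(2) c(1) by blast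
    then have "\<not> (\<exists>i\<in>UNIV. Poly_Mapping.lookup c i < Poly_Mapping.lookup b i)"
      using sum_strict_mono_ex1[of UNIV "Poly_Mapping.lookup c" "Poly_Mapping.lookup b"] c(2)
      by (auto simp: divides_exp_def)
    then have "Poly_Mapping.lookup c i = Poly_Mapping.lookup b i" for i
      using c(2) by (metis UNIV_I divides_exp_def order_le_less)
    then show ?thesis by (rule poly_mapping_eqI)
  qed
  then show thesis using b(1) that by (auto simp: min_exponents_def)
qed

lemma min_gens_eq: "min_gens I = monomial ` min_exponents (exponents I)"
proof -
  have "(\<forall>v\<in>range monomial \<inter> I. Q v) \<longleftrightarrow> (\<forall>b. monomial b \<in> I \<longrightarrow> Q (monomial b))" for Q
    by blast
  then have "monomial a \<in> min_gens I \<longleftrightarrow> a \<in> min_exponents (exponents I)" for a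
    by (simp add: min_gens_def monomials_def min_exponents_def exponents_def
        monomial_dvd_iff monomial_inj)
  moreover have "min_gens I \<subseteq> range monomial"
    by (auto simp: min_gens_def monomials_def)
  ultimately show ?thesis by blast
qed

text \<open>
The least common multiple takes the maximum in each coordinate; the inserted zero makes it the
monomial \<open>1\<close> if there are no generators.
\<close>

lemma lcm_ideal_eq_monomial:
  fixes I :: "('n::finite, 'k::field) mpoly set"
  obtains m where "lcm_ideal I = monomial m"
    "\<And>a. a \<in> min_exponents (exponents I) \<Longrightarrow> divides_exp a m"
proof -
  let ?M = "min_exponents (exponents I)"
  define m where "m = Abs_poly_mapping (\<lambda>i. Max (insert 0 ((\<lambda>a. Poly_Mapping.lookup a i) ` ?M)))"
  have m: "Poly_Mapping.lookup m i = Max (insert 0 ((\<lambda>a. Poly_Mapping.lookup a i) ` ?M))" for i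
    unfolding m_def by simp
  have fin: "finite ?M" by (rule finite_min_exponents)
  have upper: "divides_exp a m" if "a \<in> ?M" for a
    unfolding divides_exp_def m using fin that by (auto intro: Max_ge)
  have least: "divides_exp m b" if "\<And>a. a \<in> ?M \<Longrightarrow> divides_exp a b" for b
    unfolding divides_exp_def m using fin that by (auto simp: divides_exp_def)
  have "lcm_ideal I = monomial m"
    unfolding lcm_ideal_def min_gens_eq
  proof (rule the_equality)
    show "monomial m \<in> (monomials :: ('n, 'k) mpoly set) \<and> (\<forall>u\<in>monomial ` ?M. u dvd (monomial m :: ('n, 'k) mpoly)) \<and>
      (\<forall>m'\<in>monomials. (\<forall>u\<in>monomial ` ?M. u dvd m') \<longrightarrow> monomial m dvd (m' :: ('n, 'k) mpoly))"
      using upper least by (auto simp: monomials_def monomial_dvd_iff)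
  next
    fix l :: "('n, 'k) mpoly"
    assume l: "l \<in> monomials \<and> (\<forall>u\<in>monomial ` ?M. u dvd l) \<and>
      (\<forall>m'\<in>monomials. (\<forall>u\<in>monomial ` ?M. u dvd m') \<longrightarrow> l dvd m')"
    then obtain c where c: "l = monomial c" by (auto simp: monomials_def)
    have "divides_exp a c" if "a \<in> ?M" for a
      using l that unfolding c by (simp add: monomial_dvd_iff)
    then have mc: "divides_exp m c" by (rule least)
    have "monomial m \<in> (monomials :: ('n, 'k) mpoly set)" by (simp add: monomials_def)
    moreover have "\<forall>u\<in>monomial ` ?M. u dvd (monomial m :: ('n, 'k) mpoly)"
      using upper by (simp add: monomial_dvd_iff)
    ultimately have "l dvd monomial m" using l by blast
    then have cm: "divides_exp c m" unfolding c by (simp only: monomial_dvd_iff)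
    from divides_exp_antisym[OF cm mc] show "l = monomial m" unfolding c by simp
  qed
  then show thesis using upper that by blast
qed

text \<open>
A minimal exponent below \<open>a + unit_vec i\<close> has \<open>i\<close>-th coordinate at most \<open>m\<^sub>i\<close>, so it is already
below \<open>a\<close>.
\<close>

lemma exponent_reduce_above_lcm:
  fixes E :: "('n::finite \<Rightarrow>\<^sub>0 nat) set"
  assumes up: "up_closed E"
    and m: "\<And>b. b \<in> min_exponents E \<Longrightarrow> divides_exp b m"
    and a: "a + unit_vec i \<in> E" "Poly_Mapping.lookup m i \<le> Poly_Mapping.lookup a i"
  shows "a \<in> E"
proof -
  obtain b where b: "b \<in> min_exponents E" "divides_exp b (a + unit_vec i)"
    using min_exponent_below[OF a(1)] by blast
  have "Poly_Mapping.lookup b j \<le> Poly_Mapping.lookup a j" for j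
  proof (cases "j = i")
    case True
    then show ?thesis using m[OF b(1)] a(2) by (auto simp: divides_exp_def intro: order_trans)
  next
    case False
    then show ?thesis using b(2) by (auto simp: divides_exp_def lookup_add lookup_unit_vec dest: spec[of _ j])
  qed
  then obtain c where "a = b + c"
    using divides_exp_iff_add unfolding divides_exp_def by blast
  moreover have "b \<in> E" using b(1) by (simp add: min_exponents_def)
  ultimately show ?thesis using up_closedD(1)[OF up] by simp
qed

section \<open>The derivative ideal\<close>

text \<open>
The derivative of \<open>x\<^sub>i x\<^sup>a\<close> is \<open>(a\<^sub>i + 1) x\<^sup>a\<close>; this is where characteristic zero enters.
\<close>

lemma monomial_in_deriv_ideal:
  fixes I :: "('n::finite, 'k::field_char_0) mpoly set"
  assumes "a \<in> deriv_exponents (exponents I)"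
  shows "monomial a \<in> deriv_ideal I"
proof -
  obtain i where i: "monomial (a + unit_vec i) \<in> I"
    using assms by (auto simp: deriv_exponents_def exponents_def)
  let ?c = "of_nat (Poly_Mapping.lookup a i + 1) :: 'k"
  have eq: "partial_deriv i (monomial (a + unit_vec i)) = Poly_Mapping.single a ?c"
    unfolding partial_deriv_def monomial_def unit_vec_def[symmetric]
    by (simp add: lookup_add lookup_unit_vec)
  have "partial_deriv i (monomial (a + unit_vec i)) \<in> {partial_deriv i f | i f. f \<in> I}"
    using i by blast
  then have "Poly_Mapping.single a ?c \<in> deriv_ideal I"
    unfolding deriv_ideal_def eq by (rule subsetD[OF genideal_self_mpoly_ring])
  then have "Poly_Mapping.single 0 (inverse ?c) * Poly_Mapping.single a ?c \<in> deriv_ideal I"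
    unfolding deriv_ideal_def by (rule ideal_multI[OF ideal_genideal_mpoly_ring])
  moreover have "?c \<noteq> 0" unfolding of_nat_eq_0_iff by simp
  ultimately show ?thesis by (simp add: mult_single monomial_def)
qed

lemma lcm_strongly_Golod_exponents:
  fixes I :: "('n::finite, 'k::field_char_0) mpoly set"
  assumes "lcm_strongly_Golod I" "lcm_ideal I = monomial m"
    and "a \<in> deriv_exponents (exponents I)" "b \<in> deriv_exponents (exponents I)"
    and "divides_exp (a + b) m"
  shows "a + b \<in> exponents I"
proof -
  have "monomial a \<otimes>\<^bsub>mpoly_ring\<^esub> monomial b \<in> deriv_ideal I \<cdot>\<^bsub>mpoly_ring\<^esub> deriv_ideal I"
    using assms(3,4) by (intro ideal_prod.prod monomial_in_deriv_ideal)
  then have "monomial (a + b) \<in> deriv_ideal I \<cdot>\<^bsub>mpoly_ring\<^esub> deriv_ideal I"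
    by (simp only: mpoly_ring_simps monomial_mult)
  moreover have "monomial (a + b) dvd lcm_ideal I"
    unfolding assms(2) monomial_dvd_iff by (rule assms(5))
  moreover have "monomial (a + b) \<in> monomials" by (simp add: monomials_def)
  ultimately have "monomial (a + b) \<in> deriv_ideal_sq I"
    unfolding deriv_ideal_sq_def trunc_ideal_def
    by (intro subsetD[OF genideal_self_mpoly_ring]) simp
  then show ?thesis
    using assms(1) unfolding lcm_strongly_Golod_def exponents_def by blast
qed

section \<open>The Koszul homology of the quotient ring\<close>

text \<open>
A ring homomorphism out of the polynomial ring carries \<open>kdiff\<close> and \<open>kprod\<close> to the Koszul
differential and product over the target. It will be the quotient map onto \<open>S/I\<close>.
\<close>

locale mpoly_ring_hom = ring_hom_cring mpoly_ring R h
  for R :: "('a, 'b) ring_scheme" (structure) and h :: "('n::{finite,linorder}, 'k::field) mpoly \<Rightarrow> 'a"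
begin

lemma signed_hom: "signed R (inversions A B) (h f) = h (esign A B * f)"
  using hom_a_inv[of f] by (cases "even (inversions A B)") (simp_all add: signed_def esign_def)

lemma finsum_hom: "(\<Oplus>\<^bsub>R\<^esub>y\<in>Y. h (f y)) = h (\<Sum>y\<in>Y. f y)"
proof (induction Y rule: infinite_finite_induct)
  case (insert y Y)
  then show ?case using hom_add[of "f y" "\<Sum>y\<in>Y. f y"] by (simp add: S.finsum_insert Pi_def)
qed (use hom_zero in simp_all)

lemma koszul_diff_hom:
  assumes "\<And>i. x i = h (pvar i)"
  shows "koszul_diff R x (\<lambda>A. h (z A)) = (\<lambda>B. h (kdiff pvar z B))"
proof -
  have "x a \<otimes> h f = h (pvar a * f)" for a f
    using hom_mult[of "pvar a" f] by (simp add: assms)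
  then show ?thesis
    unfolding koszul_diff_def kdiff_def by (simp add: signed_hom finsum_hom)
qed

lemma koszul_mult_hom:
  "(\<lambda>A. h (u A)) \<otimes>\<^bsub>koszul_algebra R\<^esub> (\<lambda>A. h (v A)) = (\<lambda>C. h (kprod u v C))"
proof -
  have "h f \<otimes> h g = h (f * g)" for f g
    using hom_mult[of f g] by simp
  then show ?thesis
    unfolding koszul_algebra_def kprod_def by (simp add: signed_hom finsum_hom)
qed

lemma koszul_add_hom:
  "(\<lambda>A. h (u A)) \<oplus>\<^bsub>koszul_algebra R\<^esub> (\<lambda>A. h (v A)) = (\<lambda>C. h (u C + v C))"
  using hom_add by (simp add: koszul_algebra_def)

end

text \<open>
Translation of a statement about lifts to the polynomial ring into one about homology classes. A
representative \<open>a\<close> of a class of degree at least one lifts to a chain \<open>u\<close> without constant term in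
its coefficient of \<open>e\<^bsub>{}\<^esub>\<close>: a cycle of positive degree has zero there, that is, an element of \<open>I\<close>
before passing to the quotient, and the corresponding coefficient of a boundary is in the ideal
\<open>(x\<^sub>1, \<dots>, x\<^sub>n)\<close>.
\<close>

lemma koszul_homology_product_zero:
  fixes I :: "('n::{finite,linorder}, 'k::field) mpoly set"
  assumes I: "ideal I mpoly_ring"
    and prod: "\<And>u v :: 'n set \<Rightarrow> ('n, 'k) mpoly.
      (\<And>A. kdiff pvar u A \<in> I) \<Longrightarrow> Poly_Mapping.lookup (u {}) 0 = 0 \<Longrightarrow>
      (\<And>A. kdiff pvar v A \<in> I) \<Longrightarrow> Poly_Mapping.lookup (v {}) 0 = 0 \<Longrightarrow> 
      \<exists>w. \<forall>A. kprod u v A - kdiff pvar w A \<in> I"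
    and E: "\<And>f. f \<in> I \<Longrightarrow> Poly_Mapping.lookup f 0 = 0"
    and ij: "i \<ge> 1" "j \<ge> 1"
    and \<alpha>: "\<alpha> \<in> koszul_homology_deg (mpoly_ring Quot I) (quotient_var I) i"
    and \<beta>: "\<beta> \<in> koszul_homology_deg (mpoly_ring Quot I) (quotient_var I) j"
  shows "\<alpha> \<otimes>\<^bsub>koszul_homology (mpoly_ring Quot I) (quotient_var I)\<^esub> \<beta> =
     \<zero>\<^bsub>koszul_homology (mpoly_ring Quot I) (quotient_var I)\<^esub>"
proof -
  interpret I: ideal I "mpoly_ring :: ('n, 'k) mpoly ring" by (rule I)
  define R where "R = mpoly_ring Quot I"
  define q where "q f = I +>\<^bsub>mpoly_ring\<^esub> f" for f
  define x where "x = quotient_var I"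
  interpret q: mpoly_ring_hom R q
    unfolding mpoly_ring_hom_def R_def q_def[abs_def]
    by (rule I.rcos_ring_hom_cring[OF cring_mpoly_ring])
  have x: "x i = q (pvar i)" for i
    by (simp add: x_def q_def quotient_var_def mpoly_var_def monomial_def unit_vec_def)
  have q_eq: "q f = q g \<longleftrightarrow> f - g \<in> I" for f g
    using I.quotient_eq_iff_same_a_r_cos[OF I, of f g]
    by (simp add: q_def a_minus_def)
  have q_zero: "\<zero>\<^bsub>R\<^esub> = q 0" using q.hom_zero by simp
  have carrier_R: "carrier R = range q"
    by (auto simp: R_def q_def FactRing_def A_RCOSETS_def')
  let ?K = "koszul_algebra R :: ('n set \<Rightarrow> _) ring"
  let ?B = "koszul_boundaries R x"
  have lift: "\<exists>z. y = (\<lambda>A. q (z A))" if "y \<in> carrier ?K" for y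
  proof -
    have "\<forall>A. \<exists>f. y A = q f" using that carrier_R by (simp add: koszul_algebra_def image_iff)
    then show ?thesis by metis
  qed
  have carrier_K: "(\<lambda>A. q (z A)) \<in> carrier ?K" for z
    using carrier_R by (simp add: koszul_algebra_def)
  have B: "?B = range (\<lambda>w A. q (kdiff pvar w A))"
  proof (intro equalityI subsetI)
    fix b assume "b \<in> ?B"
    then obtain y where "y \<in> carrier ?K" "b = koszul_diff R x y"
      unfolding koszul_boundaries_def by blast
    then show "b \<in> range (\<lambda>w A. q (kdiff pvar w A))"
      using lift[of y] q.koszul_diff_hom[of x, OF x] by auto
  next
    fix b assume "b \<in> range (\<lambda>w A. q (kdiff pvar w A))"
    then obtain w where "b = koszul_diff R x (\<lambda>A. q (w A))"
      using q.koszul_diff_hom[of x, OF x] by auto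
    then show "b \<in> ?B"
      unfolding koszul_boundaries_def using carrier_K by blast
  qed
  \<comment> \<open>Translation by a boundary permutes the boundaries. The coset is formed in the subring of
    cycles, but the addition is that of the Koszul algebra whatever the carrier.\<close>
  have coset_B: "?B +>\<^bsub>?K\<lparr>carrier := C\<rparr>\<^esub> b = ?B" if b: "b \<in> ?B" for b C
  proof -
    obtain w where w: "b = (\<lambda>A. q (kdiff pvar w A))" using b unfolding B by blast
    have add: "(\<lambda>A. q (kdiff pvar w' A)) \<oplus>\<^bsub>?K\<^esub> b = (\<lambda>A. q (kdiff pvar (\<lambda>B. w' B + w B) A))" for w'
      unfolding w q.koszul_add_hom kdiff_add ..
    have "?B +>\<^bsub>?K\<lparr>carrier := C\<rparr>\<^esub> b = (\<lambda>y. y \<oplus>\<^bsub>?K\<^esub> b) ` ?B"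
      by (auto simp: a_r_coset_def')
    also have "\<dots> = range (\<lambda>w' A. q (kdiff pvar (\<lambda>B. w' B + w B) A))"
      unfolding B image_image add ..
    also have "\<dots> = (\<lambda>w A. q (kdiff pvar w A)) ` range (\<lambda>w' B. w' B + w B)"
      by (simp only: image_image)
    also have "range (\<lambda>w' B. w' B + w B) = UNIV"
      by (rule surjI[of _ "\<lambda>w' B. w' B - w B"]) simp
    also have "range (\<lambda>w A. q (kdiff pvar w A)) = ?B"
      by (rule B[symmetric])
    finally show ?thesis .
  qed
  have elem: "\<exists>u. a = (\<lambda>A. q (u A)) \<and> (\<forall>A. kdiff pvar u A \<in> I) \<and> Poly_Mapping.lookup (u {}) 0 = 0"
    if \<gamma>: "\<gamma> \<in> koszul_homology_deg R x n" and n: "n \<ge> 1" and a: "a \<in> \<gamma>" for \<gamma> n a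
  proof -
    obtain y where y: "\<gamma> = ?B +>\<^bsub>?K\<^esub> y" "y \<in> koszul_cycles R x" "y \<in> koszul_chains R n"
      using \<gamma> unfolding koszul_homology_deg_def by blast
    have "y \<in> carrier ?K" using y(2) by (simp add: koszul_cycles_def)
    then obtain z where z: "y = (\<lambda>A. q (z A))" using lift by blast
    have "koszul_diff R x y = \<zero>\<^bsub>?K\<^esub>" using y(2) by (simp add: koszul_cycles_def)
    then have dz: "kdiff pvar z A \<in> I" for A
      unfolding z q.koszul_diff_hom[of x, OF x] using q_zero q_eq[of _ 0]
      by (simp add: koszul_algebra_def fun_eq_iff)
    have "y {} = \<zero>\<^bsub>R\<^esub>" using y(3) n by (simp add: koszul_chains_def)
    then have "z {} \<in> I" using q_zero q_eq[of "z {}" 0] z by simp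
    then have z0: "Poly_Mapping.lookup (z {}) 0 = 0" by (rule E)
    obtain w where w: "a = (\<lambda>A. q (kdiff pvar w A)) \<oplus>\<^bsub>?K\<^esub> y"
      using a unfolding y(1) B a_r_coset_def' by blast
    let ?u = "\<lambda>A. kdiff pvar w A + z A"
    have "a = (\<lambda>A. q (?u A))" unfolding w z q.koszul_add_hom ..
    moreover have "kdiff pvar ?u A \<in> I" for A
      using dz[of A] by (simp add: kdiff_add kdiff_kdiff)
    moreover have "Poly_Mapping.lookup (?u {}) 0 = 0"
      by (simp add: lookup_add lookup_kdiff z0)
    ultimately show ?thesis by (intro exI[of _ ?u] conjI allI)
  qed
  have nonempty: "\<gamma> \<noteq> {}" if "\<gamma> \<in> koszul_homology_deg R x n" for \<gamma> n
    using that unfolding koszul_homology_deg_def B by (auto simp: a_r_coset_def')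
  have "?B +>\<^bsub>?K\<lparr>carrier := koszul_cycles R x\<rparr>\<^esub> (a \<otimes>\<^bsub>?K\<^esub> b) = ?B" if a: "a \<in> \<alpha>" and b: "b \<in> \<beta>" for a b
  proof (rule coset_B)
    obtain u where u: "a = (\<lambda>A. q (u A))" "\<And>A. kdiff pvar u A \<in> I" "Poly_Mapping.lookup (u {}) 0 = 0"
      using elem[OF \<alpha>[folded R_def x_def] ij(1) a] by blast
    obtain v where v: "b = (\<lambda>A. q (v A))" "\<And>A. kdiff pvar v A \<in> I" "Poly_Mapping.lookup (v {}) 0 = 0"
      using elem[OF \<beta>[folded R_def x_def] ij(2) b] by blast
    obtain w where "\<And>A. kprod u v A - kdiff pvar w A \<in> I"
      using prod[OF u(2,3) v(2,3)] by blast
    then have "q (kprod u v A) = q (kdiff pvar w A)" for A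
      by (simp only: q_eq)
    then have "a \<otimes>\<^bsub>?K\<^esub> b = (\<lambda>A. q (kdiff pvar w A))"
      unfolding u(1) v(1) q.koszul_mult_hom by simp
    then show "a \<otimes>\<^bsub>?K\<^esub> b \<in> ?B" unfolding B by blast
  qed
  moreover obtain a0 b0 where "a0 \<in> \<alpha>" "b0 \<in> \<beta>"
    using nonempty[OF \<alpha>[folded R_def x_def]] nonempty[OF \<beta>[folded R_def x_def]] by blast
  ultimately have "(\<Union>a\<in>\<alpha>. \<Union>b\<in>\<beta>. ?B +>\<^bsub>?K\<lparr>carrier := koszul_cycles R x\<rparr>\<^esub> (a \<otimes>\<^bsub>?K\<^esub> b)) = ?B"
    by blast
  then have "\<alpha> \<otimes>\<^bsub>koszul_homology R x\<^esub> \<beta> = \<zero>\<^bsub>koszul_homology R x\<^esub>"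
    unfolding koszul_homology_def FactRing_def rcoset_mult_def by simp
  then show ?thesis unfolding R_def x_def .
qed

lemma monomial_ideal_imp_homogeneous: "monomial_ideal I \<Longrightarrow> homogeneous_ideal d I"
proof -
  assume "monomial_ideal I"
  then obtain M where M: "M \<subseteq> monomials" "I = Idl\<^bsub>mpoly_ring\<^esub> M"
    unfolding monomial_ideal_def by blast
  have "homogeneous_poly d f" if "f \<in> M" for f
    using that M(1) by (auto simp: homogeneous_poly_def monomials_def monomial_def)
  then show ?thesis using M(2) unfolding homogeneous_ideal_def by blast
qed

theorem theorem4p6:
  fixes d :: "'n::{finite,linorder} \<Rightarrow> nat"
    and I :: "('n, 'k::field_char_0) mpoly set"
  assumes "\<And>i. d i > 0"
    and "monomial_ideal I"
    and "I \<noteq> carrier mpoly_ring"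
    and "lcm_strongly_Golod I"
  shows "weakly_Golod d I"
proof -
  note mono = \<open>monomial_ideal I\<close>
  have ideal: "ideal I mpoly_ring" using mono by (rule monomial_ideal_imp_ideal)
  have up: "up_closed (exponents I)" using ideal by (rule up_closed_exponents)
  have mem: "f \<in> I \<longleftrightarrow> Poly_Mapping.keys f \<subseteq> exponents I" for f
    using mono by (rule monomial_ideal_mem_iff)
  \<comment> \<open>A constant term would put \<open>1\<close> into the proper ideal \<open>I\<close>.\<close>
  have no_const: "Poly_Mapping.lookup f 0 = 0" if "f \<in> I" for f
  proof (rule ccontr)
    assume "Poly_Mapping.lookup f 0 \<noteq> 0"
    then have "0 \<in> exponents I" using that mem by (auto simp: in_keys_iff)
    then have "a \<in> exponents I" for a
      using up_closedD(2)[OF up, of 0 a] by simp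
    then have "I = UNIV" using mem by blast
    then show False using assms(3) by simp
  qed
  obtain m where m: "lcm_ideal I = monomial m"
    "\<And>a. a \<in> min_exponents (exponents I) \<Longrightarrow> divides_exp a m"
    using lcm_ideal_eq_monomial by blast
  have prod: "\<exists>w. \<forall>A. kprod u v A - kdiff pvar w A \<in> I"
    if "\<And>A. kdiff pvar u A \<in> I" "Poly_Mapping.lookup (u {}) 0 = 0"
      "\<And>A. kdiff pvar v A \<in> I" "Poly_Mapping.lookup (v {}) 0 = 0"
    for u v :: "'n set \<Rightarrow> ('n, 'k) mpoly"
  proof -
    have "\<exists>w. coeffs_in (exponents I) (\<lambda>A. kprod u v A - kdiff pvar w A)"
    proof (rule kprod_boundary_modulo[OF up, where \<mu> = "Poly_Mapping.lookup m"])
      show "a + b \<in> exponents I" if "a \<in> deriv_exponents (exponents I)"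
        "b \<in> deriv_exponents (exponents I)"
        "\<And>i. Poly_Mapping.lookup (a + b) i \<le> Poly_Mapping.lookup m i" for a b
        using lcm_strongly_Golod_exponents[OF assms(4) m(1) that(1,2)] that(3)
        by (simp add: divides_exp_def)
      show "a \<in> exponents I" if "a + unit_vec i \<in> exponents I"
        "Poly_Mapping.lookup m i \<le> Poly_Mapping.lookup a i" for a i
        using exponent_reduce_above_lcm[OF up m(2) that] .
    qed (use that mem in \<open>simp_all add: coeffs_in_def\<close>)
    then show ?thesis by (simp add: coeffs_in_def mem)
  qed
  show ?thesis
    unfolding weakly_Golod_def Let_def
    using monomial_ideal_imp_homogeneous[OF mono] assms(3)
      koszul_homology_product_zero[OF ideal prod no_const] by blast
qed

end
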